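(* For all integers $k, m \ge 1$ there exists a polynomial $P \in \mathbb{Q}[x_2, x_3, x_5, x_7, \ldots, x_{2i+1}, \ldots]$ with rational coefficients (depending on $k,m$) such that $$\zeta(\{1\}^k, \overline{2m}) = P\big(\zeta(2), \zeta(3), \zeta(5), \ldots, \zeta(2i+1), \ldots\big) - \sum_{n=m+1}^{m+\lceil k/2 \rceil} [z^{2m-2}] E_{2n-3}(z) \cdot \zeta\big(\{1\}^{k+1-2(n-m)}, \overline{2n-1}\big).$$
   Context: For integers $j \ge 0$ and $r \geq 2$, the alternating multiple zeta value is $$\zeta(\{1\}^j, \overline{r}) = \sum_{0<n_1<\cdots<n_j<n_{j+1}} \frac{(-1)^{n_{j+1}}}{n_1 \cdots n_j \, n_{j+1}^{r}},$$ where $\{1\}^j$ denotes the string $1,\ldots,1$ with $j$ repetitions, so that $\zeta(\{1\}^0,\overline{r}) = \zeta(\overline{r}) = \sum_{n\ge1} (-1)^n/n^r$. The values $\zeta(2),\zeta(3),\ldots$ are those of the Riemann zeta function. The Euler polynomials $E_j(x)$ are defined by $\sum_{j\ge 0} E_j(x)\frac{t^j}{j!} = \frac{2e^{tx}}{1+e^t}$. For a polynomial $F(z)$, $[z^a]F(z)$ denotes the coefficient of $z^a$ in $F(z)$. *)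

theory Defs
  imports
    "HOL-Analysis.Analysis"
    "HOL-Library.Poly_Mapping"
    "HOL-Computational_Algebra.Polynomial"
    "HOL-Computational_Algebra.Formal_Power_Series"
begin

definition zeta_nat :: "nat \<Rightarrow> real" where
  "zeta_nat s = suminf (\<lambda>n. 1 / real (Suc n) ^ s)"

(* The leading 0 in the ordering condition expresses 0 < n_1. *)
definition index_lists :: "nat \<Rightarrow> nat list set" where
  "index_lists l = {ns. length ns = l \<and> sorted_wrt (<) (0 # ns)}"

definition alt_zeta_term :: "nat \<Rightarrow> nat list \<Rightarrow> real" where
  "alt_zeta_term r ns =
     (-1) ^ last ns / ((\<Prod>n\<leftarrow>butlast ns. real n) * real (last ns) ^ r)"

definition alt_zeta :: "nat \<Rightarrow> nat \<Rightarrow> real" where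
  "alt_zeta j r = (\<Sum>\<^sub>\<infinity>ns\<in>index_lists (Suc j). alt_zeta_term r ns)"

lemma alt_zeta_term_summable:
  assumes r: "r \<ge> 2"
  shows "alt_zeta_term r summable_on index_lists (Suc j)"
proof -
  define e where "e = 1 / real (Suc j)"
  have e: "e > 0" by (simp add: e_def)
  define g where "g n = real n powr (- (1 + e))" for n
  have g_nonneg: "g n \<ge> 0" for n by (simp add: g_def)
  have "summable g"
    unfolding g_def using e by (subst summable_real_powr_iff) auto
  then have g_sum: "(g has_sum infsum g UNIV) UNIV"
    using g_nonneg by (intro has_sum_infsum summable_nonneg_imp_summable_on) auto
  define L where "L l = {ns :: nat list. length ns = l}" for l
  have prod_sum: "(\<lambda>ns. prod_list (map g ns)) summable_on L l" for l
  proof (induction l)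
    case 0
    show ?case by (simp add: L_def)
  next
    case (Suc l)
    have inj: "inj_on (\<lambda>(ns, n). n # ns) (L l \<times> UNIV)" by (auto simp: inj_on_def)
    have img: "(\<lambda>(ns, n). n # ns) ` (L l \<times> UNIV) = L (Suc l)"
      by (force simp: L_def length_Suc_conv image_iff)
    have nn: "prod_list (map g ns) \<ge> 0" for ns
      using g_nonneg by (intro prod_list_nonneg) auto
    have "(\<lambda>(ns, n). prod_list (map g ns) * g n) summable_on (L l \<times> UNIV)"
    proof (rule summable_on_SigmaI)
      show "((\<lambda>n. case (ns, n) of (ns, n) \<Rightarrow> prod_list (map g ns) * g n) has_sum
              prod_list (map g ns) * infsum g UNIV) UNIV" for ns
        using has_sum_cmult_right[OF g_sum] by simp
      show "(\<lambda>ns. prod_list (map g ns) * infsum g UNIV) summable_on L l"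
        by (rule summable_on_cmult_left[OF Suc.IH])
    qed (use nn g_nonneg in auto)
    then show ?case
      unfolding img[symmetric] summable_on_reindex[OF inj]
      by (simp add: comp_def case_prod_unfold mult.commute)
  qed
  have bound: "(\<Prod>n\<leftarrow>ns. 1 / real n) * real N powr (- e * length ns) \<le> prod_list (map g ns)"
    if "\<forall>n\<in>set ns. 0 < n \<and> n \<le> N" "N > 0" for ns N
    using that
  proof (induction ns)
    case (Cons n ns)
    from Cons.prems have n: "0 < n" "n \<le> N" by auto
    have "real N powr (- e) \<le> real n powr (- e)"
      using n e by (intro powr_mono2') auto
    then have "1 / real n * real N powr (- e) \<le> 1 / real n * real n powr (- e)"
      by (intro mult_left_mono) auto
    also have "\<dots> = g n"
      using n by (simp add: g_def powr_diff powr_minus field_simps)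
    finally have 1: "1 / real n * real N powr (- e) \<le> g n" .
    have 2: "(\<Prod>n\<leftarrow>ns. 1 / real n) * real N powr (- e * length ns) \<le> prod_list (map g ns)"
      using Cons by simp
    have "(\<Prod>n\<leftarrow>n # ns. 1 / real n) * real N powr (- e * length (n # ns)) =
      (1 / real n * real N powr (- e)) * ((\<Prod>n\<leftarrow>ns. 1 / real n) * real N powr (- e * length ns))"
      by (simp add: powr_add[symmetric] algebra_simps)
    also have "\<dots> \<le> g n * prod_list (map g ns)"
      using 1 2 g_nonneg
      by (intro mult_mono) (auto intro!: mult_nonneg_nonneg prod_list_nonneg)
    finally show ?case by simp
  qed simp
  have le: "norm (alt_zeta_term r ns) \<le> prod_list (map g ns)" if "ns \<in> index_lists (Suc j)" for ns
  proof -
    from that obtain ms N where ns: "ns = ms @ [N]" and len: "length ms = j"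
      by (cases ns rule: rev_cases) (auto simp: index_lists_def)
    from that have ms: "\<forall>n\<in>set ms. 0 < n \<and> n \<le> N" and N: "N > 0"
      by (auto simp: ns index_lists_def sorted_wrt_append intro: less_imp_le)
    have inv: "1 / (\<Prod>n\<leftarrow>ms. real n) = (\<Prod>n\<leftarrow>ms. 1 / real n)"
      by (induction ms) (simp_all del: divide_divide_eq_left flip: divide_divide_eq_left')
    have nn: "(\<Prod>n\<leftarrow>ms. 1 / real n) \<ge> 0" by (intro prod_list_nonneg) auto
    have "norm (alt_zeta_term r ns) = (\<Prod>n\<leftarrow>ms. 1 / real n) * (1 / real N ^ r)"
      using nn by (simp add: alt_zeta_term_def ns inv[symmetric] abs_mult power_abs)
    also have "\<dots> \<le> (\<Prod>n\<leftarrow>ms. 1 / real n) * (1 / real N ^ 2)"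
      using N r nn by (intro mult_left_mono divide_left_mono power_increasing) auto
    also have "1 / real N ^ 2 = real N powr (- e * length ms) * g N"
    proof -
      have "e * real (Suc j) = 1" by (simp add: e_def del: of_nat_Suc)
      moreover have "e * real (Suc j) = e * real j + e" by (simp add: distrib_left)
      ultimately have "- e * length ms + - (1 + e) = - 2" unfolding len by linarith
      then have "real N powr (- e * length ms) * g N = real N powr (- 2)"
        by (simp only: g_def powr_add[symmetric])
      then show ?thesis using N by (simp add: powr_minus_divide)
    qed
    also have "(\<Prod>n\<leftarrow>ms. 1 / real n) * (real N powr (- e * length ms) * g N)
      \<le> prod_list (map g ms) * g N"
      using mult_right_mono[OF bound[OF ms N] g_nonneg[of N]] by (simp only: mult.assoc)
    finally show ?thesis by (simp add: ns)
  qed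
  have "(\<lambda>ns. prod_list (map g ns)) summable_on index_lists (Suc j)"
    by (rule summable_on_subset_banach[OF prod_sum[of "Suc j"]]) (auto simp: L_def index_lists_def)
  then have "(\<lambda>ns. norm (alt_zeta_term r ns)) summable_on index_lists (Suc j)"
    by (rule Infinite_Sum.abs_summable_on_comparison_test') (rule le)
  then show ?thesis by (rule abs_summable_summable)
qed

(* The generating function exp (t x) * (2 / (1 + exp t)) as a power series in t whose
   coefficients are polynomials in x. The quotient does not involve x, so it is formed over
   the coefficient field and then embedded coefficientwise. *)
definition euler_poly_fps :: "'a::field_char_0 poly fps" where
  "euler_poly_fps =
     Abs_fps (\<lambda>n. monom (1 / fact n) n) * Abs_fps (\<lambda>n. [:fps_nth (2 / (1 + fps_exp 1)) n:])"

definition euler_poly :: "nat \<Rightarrow> 'a::field_char_0 poly" where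
  "euler_poly j = smult (fact j) (fps_nth euler_poly_fps j)"

lemma euler_poly_generating_function:
  fixes x :: "'a::field_char_0"
  shows "Abs_fps (\<lambda>j. poly (euler_poly j) x / fact j) = 2 * fps_exp x / (1 + fps_exp 1)"
proof -
  have "fps_nth (1 + fps_exp 1 :: 'a fps) 0 \<noteq> 0" by simp
  then have *: "2 * fps_exp x / (1 + fps_exp 1) = fps_exp x * (2 / (1 + fps_exp 1))"
    by (simp add: fps_divide_unit mult_ac)
  show ?thesis unfolding *
    by (rule fps_ext)
      (auto simp: euler_poly_def euler_poly_fps_def fps_mult_nth poly_sum poly_monom
        intro!: sum.cong)
qed

(* Polynomials in countably many variables x_i with rational coefficients, as finitely
   supported maps from monomials to coefficients; a monomial is a finitely supported map
   from variable indices to exponents. *)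
type_synonym rat_mpoly = "(nat \<Rightarrow>\<^sub>0 nat) \<Rightarrow>\<^sub>0 rat"

definition mpoly_vars :: "rat_mpoly \<Rightarrow> nat set" where
  "mpoly_vars P = (\<Union>m\<in>Poly_Mapping.keys P. Poly_Mapping.keys m)"

definition mpoly_eval :: "(nat \<Rightarrow> real) \<Rightarrow> rat_mpoly \<Rightarrow> real" where
  "mpoly_eval x P =
     (\<Sum>m\<in>Poly_Mapping.keys P. of_rat (Poly_Mapping.lookup P m) *
        (\<Prod>i\<in>Poly_Mapping.keys m. x i ^ Poly_Mapping.lookup m i))"

end

theory Submission
  imports Defs "HOL-Complex_Analysis.Cauchy_Integral_Formula"
begin

text \<open>
  Fix the weight and write \<open>d = 2 m - 2 + k\<close> and \<open>T\<^sub>i = \<zeta>({1}\<^sup>d\<^sup>-\<^sup>i, i + 2)\<close> with a bar on the last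
  entry, so that the left-hand side of the theorem is \<open>T\<^sub>i\<close> for \<open>i = 2 m - 2\<close> and the sum on
  the right consists of multiples of \<open>T\<^sub>j\<close> with odd \<open>j > i\<close>.  Let \<open>R\<close> be the ring of values of
  rational polynomials at \<open>\<zeta>(2), \<zeta>(3), \<zeta>(5), \<dots>\<close>.  The theorem is a linear congruence between the
  \<open>T\<^sub>j\<close> modulo \<open>R\<close>.

  The congruences come from a symmetry of the polynomial \<open>U\<^sub>d(x) = \<Sum>\<^sub>i T\<^sub>i x\<^sup>i\<close>: the polynomial
  \<open>U\<^sub>d(-x) + U\<^sub>d(x - 1)\<close> has all its coefficients in \<open>R\<close>.  To see this, split the Beta integral
  at \<open>1/2\<close>.  The substitution \<open>x = t / (1 + t)\<close> and the binomial series give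
  \<open>B(u, v) = \<Sum>\<^sub>N C(-(u + v), N) (1 / (N + u) + 1 / (N + v))\<close> (\<open>Beta_eq_series\<close>).
  Put \<open>u = x s\<close> and \<open>v = (1 - x) s\<close> and expand in powers of \<open>s\<close>.  Since \<open>C(-s, N)\<close> is, up to sign,
  \<open>s / N\<close> times the product of \<open>1 + s / n\<close> over \<open>n < N\<close>, each of the two halves is a generating
  function of the values \<open>T\<^sub>i\<close> of all weights (\<open>alt_zeta_poly_sums\<close>).  On the other side,
  \<open>x (1 - x) s B(u, v) = \<Gamma>(1 + u) \<Gamma>(1 + v) / \<Gamma>(1 + s)\<close>, and the logarithmic derivative of this
  quotient in \<open>s\<close> is a power series whose coefficients are zeta values times integer polynomials
  in \<open>x\<close>.  Comparing coefficients gives a recurrence (\<open>Gamma_quot_coeff_recurrence\<close>) which keeps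
  everything inside \<open>R\<close> as soon as all \<open>\<zeta>(n)\<close> lie in \<open>R\<close>.  For even \<open>n \<ge> 4\<close> this follows from the
  same recurrence: its coefficient of \<open>x\<^sup>n\<close> expresses a nonzero rational multiple of \<open>\<zeta>(n)\<close> by
  smaller zeta values (\<open>zeta_nat_even_step\<close>).

  Coefficientwise the symmetry reads \<open>T\<^sub>i + \<Sum>\<^sub>j (-1)\<^sup>j C(j, i) T\<^sub>j \<in> R\<close> (\<open>alt_zeta_relation\<close>).
  The combination of these relations with weights \<open>C(n, i) e\<^sub>n\<^sub>-\<^sub>i\<close>, where \<open>e\<^sub>j = E\<^sub>j(0)\<close>, collapses
  because of \<open>e\<^sub>n + \<Sum>\<^sub>l C(n, l) e\<^sub>l = 0\<close> for \<open>n > 0\<close>, and \<open>e\<^sub>j = 0\<close> for even \<open>j > 0\<close>.  What remains for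
  even \<open>i\<close> is twice \<open>\<Sum>\<^sub>j C(j, i) e\<^sub>j\<^sub>-\<^sub>i T\<^sub>j\<close> (\<open>even_alt_zeta_reduction\<close>), and \<open>C(j, i) e\<^sub>j\<^sub>-\<^sub>i\<close> is the
  coefficient of \<open>z\<^sup>i\<close> in \<open>E\<^sub>j(z)\<close>.
\<close>

section \<open>Polynomials in zeta values\<close>

definition zeta_ring :: "real set" where
  "zeta_ring = {mpoly_eval zeta_nat P |P. mpoly_vars P \<subseteq> {2} \<union> {2 * i + 1 |i. i \<ge> 1}}"

definition monom_eval :: "(nat \<Rightarrow> real) \<Rightarrow> (nat \<Rightarrow>\<^sub>0 nat) \<Rightarrow> real" where
  "monom_eval x m = (\<Prod>i\<in>Poly_Mapping.keys m. x i ^ Poly_Mapping.lookup m i)"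

lemma mpoly_eval_monom_eval:
  "mpoly_eval x P = (\<Sum>m\<in>Poly_Mapping.keys P. of_rat (Poly_Mapping.lookup P m) * monom_eval x m)"
  by (simp add: mpoly_eval_def monom_eval_def)

lemma monom_eval_superset:
  assumes "finite A" "Poly_Mapping.keys m \<subseteq> A"
  shows "monom_eval x m = (\<Prod>i\<in>A. x i ^ Poly_Mapping.lookup m i)"
  unfolding monom_eval_def using assms
  by (intro prod.mono_neutral_left) (auto simp: in_keys_iff)

lemma monom_eval_add: "monom_eval x (m + m') = monom_eval x m * monom_eval x m'"
proof -
  define A where "A = Poly_Mapping.keys m \<union> Poly_Mapping.keys m'"
  have "finite A" and sub: "Poly_Mapping.keys m \<subseteq> A" "Poly_Mapping.keys m' \<subseteq> A"
      "Poly_Mapping.keys (m + m') \<subseteq> A"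
    using keys_add[of m m'] by (auto simp: A_def)
  then show ?thesis
    by (simp add: monom_eval_superset[of A] lookup_add power_add prod.distrib)
qed

lemma mpoly_eval_zero [simp]: "mpoly_eval x 0 = 0"
  by (simp add: mpoly_eval_def)

lemma mpoly_eval_add: "mpoly_eval x (P + Q) = mpoly_eval x P + mpoly_eval x Q"
  unfolding mpoly_eval_monom_eval
  by (rule setsum_keys_plus_distrib) (simp_all add: of_rat_add distrib_right)

lemma mpoly_eval_single: "mpoly_eval x (Poly_Mapping.single m c) = of_rat c * monom_eval x m"
  by (simp add: mpoly_eval_monom_eval)

text \<open>
  Both sides of a multiplicativity statement are additive in each factor, so single terms
  suffice; this induction replaces a computation with the convolution formula for products.
\<close>

lemma mpoly_add_induct [case_names zero single add]:
  fixes P :: rat_mpoly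
  assumes "Q 0" and "\<And>m c. Q (Poly_Mapping.single m c)"
    and "\<And>A B. Q A \<Longrightarrow> Q B \<Longrightarrow> Q (A + B)"
  shows "Q P"
proof (induction P rule: update_induct)
  case const
  then show ?case using assms(1) by simp
next
  case (update P m c)
  have "Poly_Mapping.update m c P = P + Poly_Mapping.single m c"
    using update by (intro poly_mapping_eqI)
      (auto simp: lookup_update lookup_add lookup_single in_keys_iff when_def)
  then show ?case using assms update by simp
qed

lemma mpoly_eval_mult: "mpoly_eval x (P * Q) = mpoly_eval x P * mpoly_eval x Q"
proof (induction P rule: mpoly_add_induct)
  case (single m c)
  show ?case
    by (induction Q rule: mpoly_add_induct)
      (simp_all add: mult_single mpoly_eval_single monom_eval_add of_rat_mult mpoly_eval_add
        distrib_left)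
qed (simp_all add: mpoly_eval_add distrib_right)

lemma mpoly_vars_add: "mpoly_vars (P + Q) \<subseteq> mpoly_vars P \<union> mpoly_vars Q"
  using keys_add[of P Q] by (auto simp: mpoly_vars_def)

lemma mpoly_vars_mult: "mpoly_vars (P * Q) \<subseteq> mpoly_vars P \<union> mpoly_vars Q"
proof
  fix i assume "i \<in> mpoly_vars (P * Q)"
  then obtain m where m: "m \<in> Poly_Mapping.keys (P * Q)" "i \<in> Poly_Mapping.keys m"
    by (auto simp: mpoly_vars_def)
  then obtain a b where "m = a + b" "a \<in> Poly_Mapping.keys P" "b \<in> Poly_Mapping.keys Q"
    using keys_mult[of P Q] by blast
  with m(2) keys_add[of a b] show "i \<in> mpoly_vars P \<union> mpoly_vars Q"
    by (auto simp: mpoly_vars_def)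
qed

lemma zeta_ring_add: "a \<in> zeta_ring \<Longrightarrow> b \<in> zeta_ring \<Longrightarrow> a + b \<in> zeta_ring"
  unfolding zeta_ring_def using mpoly_vars_add
  by (smt (verit, best) mem_Collect_eq mpoly_eval_add subset_trans sup.boundedI)

lemma zeta_ring_mult: "a \<in> zeta_ring \<Longrightarrow> b \<in> zeta_ring \<Longrightarrow> a * b \<in> zeta_ring"
  unfolding zeta_ring_def using mpoly_vars_mult
  by (smt (verit, best) mem_Collect_eq mpoly_eval_mult subset_trans sup.boundedI)

lemma zeta_ring_Rats: "a \<in> \<rat> \<Longrightarrow> a \<in> zeta_ring"
proof -
  assume "a \<in> \<rat>"
  then obtain q where q: "a = of_rat q" by (auto simp: Rats_def)
  show ?thesis unfolding zeta_ring_def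
    by (rule CollectI, rule exI[of _ "Poly_Mapping.single 0 q"])
       (auto simp: q mpoly_vars_def mpoly_eval_single monom_eval_def)
qed

lemma zeta_ring_generator:
  assumes "n = 2 \<or> n \<ge> 3 \<and> odd n"
  shows "zeta_nat n \<in> zeta_ring"
proof -
  have "n \<in> {2} \<union> {2 * i + 1 |i. i \<ge> 1}" using assms by (auto elim!: oddE)
  then show ?thesis unfolding zeta_ring_def
    by (intro CollectI exI[of _ "Poly_Mapping.single (Poly_Mapping.single n 1) 1"])
       (auto simp: mpoly_vars_def mpoly_eval_single monom_eval_def)
qed

lemma zeta_ring_uminus: "a \<in> zeta_ring \<Longrightarrow> - a \<in> zeta_ring"
  using zeta_ring_mult[OF zeta_ring_Rats[of "-1"]] by simp

lemma zeta_ring_diff: "a \<in> zeta_ring \<Longrightarrow> b \<in> zeta_ring \<Longrightarrow> a - b \<in> zeta_ring"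
  using zeta_ring_add[OF _ zeta_ring_uminus] by simp

lemma zeta_ring_sum: "(\<And>i. i \<in> A \<Longrightarrow> f i \<in> zeta_ring) \<Longrightarrow> sum f A \<in> zeta_ring"
  by (induction A rule: infinite_finite_induct) (auto intro: zeta_ring_add zeta_ring_Rats)

lemma zeta_ring_Rats_mult_cancel:
  assumes "q * a \<in> zeta_ring" "q \<in> \<rat>" "q \<noteq> 0"
  shows "a \<in> zeta_ring"
proof -
  have "inverse q * (q * a) \<in> zeta_ring"
    by (rule zeta_ring_mult[OF zeta_ring_Rats]) (use assms in auto)
  then show ?thesis using assms(3) by (simp flip: mult.assoc)
qed

definition coeffs_in_zeta_ring :: "real poly \<Rightarrow> bool" where
  "coeffs_in_zeta_ring p \<longleftrightarrow> (\<forall>i. coeff p i \<in> zeta_ring)"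

lemma zeta_ring_0 [simp]: "0 \<in> zeta_ring" and zeta_ring_1 [simp]: "1 \<in> zeta_ring"
  by (auto intro: zeta_ring_Rats)

lemma coeffs_in_zeta_ring_pCons:
  "a \<in> zeta_ring \<Longrightarrow> coeffs_in_zeta_ring p \<Longrightarrow> coeffs_in_zeta_ring (pCons a p)"
  by (simp add: coeffs_in_zeta_ring_def coeff_pCons split: nat.split)

lemma coeffs_in_zeta_ring_0: "coeffs_in_zeta_ring 0"
  by (simp add: coeffs_in_zeta_ring_def)

lemma coeffs_in_zeta_ring_1: "coeffs_in_zeta_ring 1"
  by (simp add: one_pCons coeffs_in_zeta_ring_pCons coeffs_in_zeta_ring_0)

lemma coeffs_in_zeta_ring_add:
  "coeffs_in_zeta_ring p \<Longrightarrow> coeffs_in_zeta_ring q \<Longrightarrow> coeffs_in_zeta_ring (p + q)"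
  by (simp add: coeffs_in_zeta_ring_def zeta_ring_add)

lemma coeffs_in_zeta_ring_diff:
  "coeffs_in_zeta_ring p \<Longrightarrow> coeffs_in_zeta_ring q \<Longrightarrow> coeffs_in_zeta_ring (p - q)"
  by (simp add: coeffs_in_zeta_ring_def zeta_ring_diff)

lemma coeffs_in_zeta_ring_smult:
  "a \<in> zeta_ring \<Longrightarrow> coeffs_in_zeta_ring p \<Longrightarrow> coeffs_in_zeta_ring (smult a p)"
  by (simp add: coeffs_in_zeta_ring_def zeta_ring_mult)

lemma coeffs_in_zeta_ring_mult:
  "coeffs_in_zeta_ring p \<Longrightarrow> coeffs_in_zeta_ring q \<Longrightarrow> coeffs_in_zeta_ring (p * q)"
  by (auto simp: coeffs_in_zeta_ring_def coeff_mult intro!: zeta_ring_sum zeta_ring_mult)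

lemma coeffs_in_zeta_ring_power:
  "coeffs_in_zeta_ring p \<Longrightarrow> coeffs_in_zeta_ring (p ^ n)"
  by (induction n) (auto intro: coeffs_in_zeta_ring_1 coeffs_in_zeta_ring_mult)

lemma coeffs_in_zeta_ring_monom: "a \<in> zeta_ring \<Longrightarrow> coeffs_in_zeta_ring (monom a n)"
  by (simp add: coeffs_in_zeta_ring_def)

lemma coeffs_in_zeta_ring_sum:
  "(\<And>i. i \<in> I \<Longrightarrow> coeffs_in_zeta_ring (p i)) \<Longrightarrow> coeffs_in_zeta_ring (sum p I)"
  by (auto simp: coeffs_in_zeta_ring_def coeff_sum intro!: zeta_ring_sum)

section \<open>Euler polynomials at zero\<close>

definition euler_const :: "nat \<Rightarrow> real" where
  "euler_const n = fact n * fps_nth (2 / (1 + fps_exp 1)) n"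

lemma coeff_euler_poly:
  assumes "i \<le> n"
  shows "coeff (euler_poly n) i = real (n choose i) * euler_const (n - i)"
proof -
  have "coeff (euler_poly n :: real poly) i =
      fact n * (\<Sum>j\<le>n. (if j = i then 1 / fact j else 0) * fps_nth (2 / (1 + fps_exp 1)) (n - j))"
    by (auto simp: euler_poly_def euler_poly_fps_def fps_mult_nth coeff_sum atMost_atLeast0
        intro!: sum.cong)
  also have "\<dots> = fact n * (fps_nth (2 / (1 + fps_exp 1)) (n - i) / fact i)"
    using assms by (subst sum.remove[of _ i]) auto
  also have "\<dots> = real (n choose i) * euler_const (n - i)"
    using assms by (simp add: euler_const_def binomial_fact)
  finally show ?thesis .
qed

lemma euler_gf_mult: "(1 + fps_exp 1) * (2 / (1 + fps_exp 1)) = (2 :: real fps)"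
proof -
  have "fps_nth (1 + fps_exp 1 :: real fps) 0 \<noteq> 0" by simp
  then show ?thesis
    by (simp add: fps_divide_unit inverse_mult_eq_1' mult.left_commute)
qed

lemma euler_const_recurrence:
  "euler_const n + (\<Sum>l\<le>n. real (n choose l) * euler_const l) = (if n = 0 then 2 else 0)"
proof -
  define F :: "real fps" where "F = 2 / (1 + fps_exp 1)"
  have "F + F * fps_exp 1 = 2"
    using euler_gf_mult by (simp add: F_def algebra_simps)
  then have "fact n * (fps_nth F n + fps_nth (F * fps_exp 1) n) = fact n * fps_nth 2 n"
    by (metis fps_add_nth)
  moreover have "fact n * fps_nth (F * fps_exp 1) n = (\<Sum>l\<le>n. real (n choose l) * euler_const l)"
    unfolding fps_mult_nth sum_distrib_left atMost_atLeast0
    by (intro sum.cong refl) (simp add: euler_const_def F_def binomial_fact)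
  moreover have "fact n * fps_nth (2 :: real fps) n = (if n = 0 then 2 else 0)"
    by (simp add: numeral_fps_const)
  ultimately show ?thesis by (simp add: euler_const_def F_def distrib_left)
qed

text \<open>
  The generating function \<open>F(t) = 2 / (1 + e\<^sup>t)\<close> satisfies \<open>F(t) + F(-t) = 2\<close>, so \<open>F - 1\<close> is odd.
\<close>

lemma euler_const_even:
  assumes "even n" "n > 0"
  shows "euler_const n = 0"
proof -
  define F :: "real fps" where "F = 2 / (1 + fps_exp 1)"
  define G where "G = F oo (- fps_X)"
  have F: "(1 + fps_exp 1) * F = 2" using euler_gf_mult by (simp add: F_def)
  have exp_neg: "fps_exp 1 oo (- fps_X) = (fps_exp (- 1) :: real fps)"
    by (rule fps_ext) (simp add: fps_compose_uminus')
  have "((1 + fps_exp 1) * F) oo (- fps_X) = (2 :: real fps)"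
    unfolding F by (simp add: numeral_fps_const)
  moreover have "((1 + fps_exp 1) * F) oo (- fps_X) = (1 + fps_exp (- 1)) * G"
    unfolding G_def
    by (subst fps_compose_mult_distrib) (auto simp: fps_compose_add_distrib exp_neg)
  ultimately have "fps_exp 1 * ((1 + fps_exp (- 1)) * G) = fps_exp 1 * 2" by simp
  moreover have "fps_exp 1 * (1 + fps_exp (- 1)) = (1 + fps_exp 1 :: real fps)"
    by (simp add: distrib_left flip: fps_exp_add_mult)
  ultimately have "(1 + fps_exp 1) * G = fps_exp 1 * 2"
    by (simp flip: mult.assoc)
  with F have "(1 + fps_exp 1) * (F + G) = (1 + fps_exp 1) * 2"
    unfolding distrib_left[of "1 + fps_exp 1" F G] by (simp add: algebra_simps)
  moreover have "1 + fps_exp 1 \<noteq> (0 :: real fps)"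
  proof -
    have "fps_nth (1 + fps_exp 1) 0 \<noteq> fps_nth (0 :: real fps) 0" by simp
    then show ?thesis by metis
  qed
  ultimately have "F + G = 2" by (metis mult_left_cancel)
  then have "fps_nth F n + fps_nth G n = fps_nth 2 n" by (metis fps_add_nth)
  moreover have "fps_nth G n = (- 1) ^ n * fps_nth F n"
    by (simp add: G_def fps_compose_uminus')
  moreover have "fps_nth (2 :: real fps) n = 0" using assms by (simp add: numeral_fps_const)
  ultimately show ?thesis using assms by (simp add: euler_const_def F_def)
qed

lemma euler_const_Rats: "euler_const n \<in> \<rat>"
proof (induction n rule: less_induct)
  case (less n)
  have "2 * euler_const n = (if n = 0 then 2 else 0) - (\<Sum>l<n. real (n choose l) * euler_const l)"
    using euler_const_recurrence[of n] by (simp add: lessThan_Suc_atMost[symmetric])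
  also have "\<dots> \<in> \<rat>" using less by (intro Rats_diff Rats_sum Rats_mult) auto
  finally have "2 * euler_const n / 2 \<in> \<rat>" by (intro Rats_divide) auto
  then show ?case by simp
qed

section \<open>Interchange of sums and uniqueness of power series\<close>

text \<open>
  A form of Fubini's theorem for iterated series.  The dominating array \<open>G\<close> is only required to
  have summable rows with summable row sums, which is what can be checked for
  products of geometric series and finite generating functions.
\<close>

lemma double_series_swap:
  fixes F G :: "nat \<Rightarrow> nat \<Rightarrow> real"
  assumes bound: "\<And>M d. \<bar>F M d\<bar> \<le> G M d"
    and row: "\<And>M. G M sums g M" and "summable g"
    and Frow: "\<And>M. F M sums r M"
    and Fcol: "\<And>d. (\<lambda>M. F M d) sums c d"
  shows "summable r \<and> c sums suminf r"
proof -
  have G0: "G M d \<ge> 0" for M d using bound[of M d] by linarith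
  have g0: "g M \<ge> 0" for M using sums_le[OF _ sums_zero row[of M]] G0 by simp
  have "(\<lambda>(M, d). G M d) summable_on UNIV \<times> UNIV"
    using G0 g0 \<open>summable g\<close> row
    by (intro summable_on_SigmaI[where g = g])
       (auto intro: sums_nonneg_imp_has_sum summable_nonneg_imp_summable_on)
  then have "(\<lambda>x. norm (case x of (M, d) \<Rightarrow> F M d)) summable_on UNIV \<times> UNIV"
    by (rule Infinite_Sum.abs_summable_on_comparison_test') (use bound in auto)
  then have F: "(\<lambda>(M, d). F M d) summable_on UNIV \<times> UNIV"
    by (rule abs_summable_summable)
  define S where "S = infsum (\<lambda>(M, d). F M d) (UNIV \<times> UNIV)"
  have hs: "((\<lambda>(M, d). F M d) has_sum S) (UNIV \<times> UNIV)"
    using F by (simp add: S_def)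
  have hs': "((\<lambda>(d, M). F M d) has_sum S) (UNIV \<times> UNIV)"
    using hs by (subst has_sum_swap) simp
  have r: "(F M has_sum r M) UNIV" for M
  proof (rule norm_summable_imp_has_sum[OF _ Frow])
    show "summable (\<lambda>d. norm (F M d))"
      by (rule summable_comparison_test'[OF sums_summable[OF row]]) (use bound in simp)
  qed
  have c: "((\<lambda>M. F M d) has_sum c d) UNIV" for d
  proof (rule norm_summable_imp_has_sum[OF _ Fcol])
    have "G M d \<le> g M" for M
      using row[of M] G0 sum_le_suminf[of "G M" "{d}"] by (auto simp: sums_iff)
    then have "\<bar>F M d\<bar> \<le> g M" for M using bound order_trans by blast
    then show "summable (\<lambda>M. norm (F M d))"
      by (intro summable_comparison_test'[OF \<open>summable g\<close>, of 0]) simp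
  qed
  have "r sums S"
    by (rule has_sum_imp_sums, rule has_sum_SigmaD[OF hs]) (use r in auto)
  moreover have "c sums S"
    by (rule has_sum_imp_sums, rule has_sum_SigmaD[OF hs']) (use c in auto)
  ultimately show ?thesis by (simp add: sums_iff)
qed

text \<open>
  The expansions below hold for positive arguments only, where the Beta integral converges.
  A one-sided neighbourhood of the origin still determines the coefficients, because the zeros of a
  nonzero power series are isolated.
\<close>

lemma power_series_zero_right:
  fixes a :: "nat \<Rightarrow> real"
  assumes "R > 0" and sums: "\<And>x. 0 < x \<Longrightarrow> x < R \<Longrightarrow> (\<lambda>n. a n * x ^ n) sums 0"
  shows "a n = 0"
proof (rule ccontr)
  assume "a n \<noteq> 0"
  \<comment> \<open>shifted by one, the series vanishes at the origin\<close>
  define b where "b n = (case n of 0 \<Rightarrow> 0 | Suc m \<Rightarrow> a m)" for n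
  define f where "f x = suminf (\<lambda>n. b n * x ^ n)" for x
  have sm: "summable (\<lambda>n. a n * x ^ n)" if x: "\<bar>x\<bar> < R" for x
  proof -
    obtain y where "\<bar>x\<bar> < y" "y < R" using dense[OF x] by blast
    then have "0 < y" by linarith
    then show ?thesis using sums[of y] \<open>y < R\<close> \<open>\<bar>x\<bar> < y\<close>
      by (rule_tac powser_inside[of a y]) (auto simp: sums_iff)
  qed
  have bs: "(\<lambda>n. b n * x ^ n) sums (x * suminf (\<lambda>n. a n * x ^ n))" if "\<bar>x\<bar> < R" for x
  proof -
    have "(\<lambda>n. x * (a n * x ^ n)) sums (x * suminf (\<lambda>n. a n * x ^ n))"
      using sm[OF that] by (intro sums_mult summable_sums)
    then have "(\<lambda>n. b (Suc n) * x ^ Suc n) sums (x * suminf (\<lambda>n. a n * x ^ n))"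
      by (simp add: b_def mult_ac)
    then show ?thesis by (subst (asm) sums_Suc_iff) (simp add: b_def)
  qed
  have f: "(\<lambda>n. b n * (x - 0) ^ n) sums f x" if "norm (x - 0) < R" for x
    using bs[of x] that by (simp add: f_def sums_iff)
  have "f 0 = 0" by (simp add: f_def b_def)
  obtain s where "0 < s" and s: "\<And>z. z \<in> cball 0 s - {0} \<Longrightarrow> f z \<noteq> 0"
    by (rule powser_0_nonzero[OF \<open>R > 0\<close> f \<open>f 0 = 0\<close>, of "Suc n"])
       (use \<open>a n \<noteq> 0\<close> in \<open>auto simp: b_def\<close>)
  define z where "z = min s (R / 2)"
  have z: "0 < z" "z \<le> s" "z < R" using \<open>0 < s\<close> \<open>R > 0\<close> by (auto simp: z_def)
  have "f z = 0" using bs[of z] sums[of z] z by (simp add: f_def sums_iff)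
  moreover have "f z \<noteq> 0" using z by (intro s) auto
  ultimately show False by simp
qed

section \<open>Alternating zeta values as single series\<close>

text \<open>
  The elementary symmetric polynomial of degree \<open>p\<close> in \<open>1, 1/2, \<dots>, 1/M\<close>, which is the inner sum
  of an alternating multiple zeta value with largest index \<open>M + 1\<close>.
\<close>

fun harmonic_esym :: "nat \<Rightarrow> nat \<Rightarrow> real" where
  "harmonic_esym 0 M = 1"
| "harmonic_esym (Suc p) 0 = 0"
| "harmonic_esym (Suc p) (Suc M) = harmonic_esym (Suc p) M + harmonic_esym p M / real (Suc M)"

lemma harmonic_esym_nonneg: "harmonic_esym p M \<ge> 0"
  by (induction p M rule: harmonic_esym.induct) auto

lemma harmonic_esym_eq_0: "M < p \<Longrightarrow> harmonic_esym p M = 0"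
  by (induction p M rule: harmonic_esym.induct) auto

text \<open>
  This is the expansion of the product of \<open>1 + x / n\<close> over \<open>1 \<le> n \<le> M\<close>.
\<close>

lemma sum_harmonic_esym:
  "(\<Sum>p\<le>M. harmonic_esym p M * x ^ p) = pochhammer (1 + x) M / fact M"
proof (induction M)
  case (Suc M)
  have "(\<Sum>p\<le>Suc M. harmonic_esym p (Suc M) * x ^ p) =
      1 + (\<Sum>p\<le>M. (harmonic_esym (Suc p) M + harmonic_esym p M / real (Suc M)) * x ^ Suc p)"
    by (subst sum.atMost_Suc_shift) simp
  also have "(\<Sum>p\<le>M. (harmonic_esym (Suc p) M + harmonic_esym p M / real (Suc M)) * x ^ Suc p)
      = (\<Sum>p\<le>M. harmonic_esym (Suc p) M * x ^ Suc p)
      + x / real (Suc M) * (\<Sum>p\<le>M. harmonic_esym p M * x ^ p)"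
    unfolding sum_distrib_left sum.distrib[symmetric]
    by (rule sum.cong)
      (simp_all add: distrib_left distrib_right mult_ac add_divide_distrib del: of_nat_Suc)
  also note add.assoc[symmetric]
  also have "1 + (\<Sum>p\<le>M. harmonic_esym (Suc p) M * x ^ Suc p)
      = (\<Sum>p\<le>Suc M. harmonic_esym p M * x ^ p)"
    by (subst sum.atMost_Suc_shift) simp
  also have "\<dots> = (\<Sum>p\<le>M. harmonic_esym p M * x ^ p)"
    by (simp add: harmonic_esym_eq_0)
  finally have "(\<Sum>p\<le>Suc M. harmonic_esym p (Suc M) * x ^ p)
      = (1 + x / real (Suc M)) * (pochhammer (1 + x) M / fact M)"
    by (simp only: Suc.IH distrib_right mult_1)
  also have "\<dots> = pochhammer (1 + x) (Suc M) / fact (Suc M)"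
    by (simp add: pochhammer_Suc field_simps)
  finally show ?case .
qed simp

definition bounded_index_lists :: "nat \<Rightarrow> nat \<Rightarrow> nat list set" where
  "bounded_index_lists p M = {ns \<in> index_lists p. \<forall>n\<in>set ns. n \<le> M}"

lemma finite_bounded_index_lists: "finite (bounded_index_lists p M)"
proof (rule finite_subset)
  show "bounded_index_lists p M \<subseteq> {ns. set ns \<subseteq> {..M} \<and> length ns = p}"
    by (auto simp: bounded_index_lists_def index_lists_def)
qed (rule finite_lists_length_eq, simp)

lemma snoc_in_index_lists_iff:
  "ms @ [N] \<in> index_lists (Suc p) \<longleftrightarrow> N > 0 \<and> ms \<in> bounded_index_lists p (N - 1)"
  by (auto simp: bounded_index_lists_def index_lists_def sorted_wrt_append less_Suc_eq_le
      dest: bspec)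

lemma index_lists_Suc_cases:
  assumes "ns \<in> index_lists (Suc p)"
  obtains ms N where "ns = ms @ [Suc N]" "ms \<in> bounded_index_lists p N"
proof -
  have "ns \<noteq> []" using assms by (auto simp: index_lists_def)
  then obtain ms N where "ns = ms @ [N]" by (cases ns rule: rev_cases) auto
  with assms that[of ms "N - 1"] show thesis by (simp add: snoc_in_index_lists_iff)
qed

lemma bounded_index_lists_Suc:
  "bounded_index_lists (Suc p) (Suc M) =
     bounded_index_lists (Suc p) M \<union> (\<lambda>ms. ms @ [Suc M]) ` bounded_index_lists p M" (is "?L = ?R")
proof (intro equalityI subsetI)
  fix ns assume ns: "ns \<in> ?L"
  then have "ns \<in> index_lists (Suc p)" by (simp add: bounded_index_lists_def)
  then obtain ms N where N: "ns = ms @ [Suc N]" "ms \<in> bounded_index_lists p N"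
    by (rule index_lists_Suc_cases)
  show "ns \<in> ?R"
  proof (cases "N = M")
    case False
    then have "N < M" using ns N by (auto simp: bounded_index_lists_def)
    then have "ns \<in> bounded_index_lists (Suc p) M"
      using ns N by (auto simp: bounded_index_lists_def)
    then show ?thesis by blast
  qed (use N in auto)
next
  fix ns assume "ns \<in> ?R"
  then show "ns \<in> ?L"
    by (force simp: bounded_index_lists_def snoc_in_index_lists_iff)
qed

lemma harmonic_esym_eq_sum:
  "harmonic_esym p M = (\<Sum>ns\<in>bounded_index_lists p M. 1 / (\<Prod>n\<leftarrow>ns. real n))"
proof (induction p M rule: harmonic_esym.induct)
  case (1 M)
  have "bounded_index_lists 0 M = {[]}" by (auto simp: bounded_index_lists_def index_lists_def)
  then show ?case by simp
next
  case (2 p)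
  have "bounded_index_lists (Suc p) 0 = {}"
    by (auto simp: bounded_index_lists_def elim: index_lists_Suc_cases)
  then show ?case by simp
next
  case (3 p M)
  have disj: "bounded_index_lists (Suc p) M \<inter> (\<lambda>ms. ms @ [Suc M]) ` bounded_index_lists p M = {}"
    by (auto simp: bounded_index_lists_def)
  have inj: "inj_on (\<lambda>ms. ms @ [Suc M]) (bounded_index_lists p M)" by (auto simp: inj_on_def)
  have "(\<Sum>ns\<in>(\<lambda>ms. ms @ [Suc M]) ` bounded_index_lists p M. 1 / (\<Prod>n\<leftarrow>ns. real n))
      = (\<Sum>ms\<in>bounded_index_lists p M. 1 / (\<Prod>n\<leftarrow>ms. real n) / real (Suc M))"
    by (subst sum.reindex[OF inj]) (simp add: comp_def)
  then show ?case
    unfolding bounded_index_lists_Suc harmonic_esym.simps 3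
      sum.union_disjoint[OF finite_bounded_index_lists
        finite_imageI[OF finite_bounded_index_lists] disj]
    by (simp only: sum_divide_distrib)
qed

text \<open>
  Group the index lists by their last entry \<open>M + 1\<close>; absolute convergence permits this.
\<close>

lemma alt_zeta_sums:
  assumes "r \<ge> 2"
  shows "(\<lambda>M. (-1) ^ Suc M * harmonic_esym j M / real (Suc M) ^ r) sums alt_zeta j r"
proof -
  let ?snoc = "\<lambda>(M, ms). ms @ [Suc M]"
  have bij: "bij_betw ?snoc (Sigma UNIV (bounded_index_lists j)) (index_lists (Suc j))"
    unfolding bij_betw_def
    by (auto simp: inj_on_def snoc_in_index_lists_iff image_iff elim!: index_lists_Suc_cases)
  have "(alt_zeta_term r has_sum alt_zeta j r) (index_lists (Suc j))"
    unfolding alt_zeta_def by (rule has_sum_infsum[OF alt_zeta_term_summable[OF assms]])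
  then have "((\<lambda>x. alt_zeta_term r (?snoc x)) has_sum alt_zeta j r)
      (Sigma UNIV (bounded_index_lists j))"
    by (subst has_sum_reindex_bij_betw[OF bij])
  then have "((\<lambda>M. \<Sum>ms\<in>bounded_index_lists j M. alt_zeta_term r (ms @ [Suc M]))
      has_sum alt_zeta j r) UNIV"
    by (rule has_sum_SigmaD) (auto intro!: has_sum_finiteI finite_bounded_index_lists)
  moreover have "(\<Sum>ms\<in>bounded_index_lists j M. alt_zeta_term r (ms @ [Suc M]))
      = (-1) ^ Suc M * harmonic_esym j M / real (Suc M) ^ r" for M
    unfolding harmonic_esym_eq_sum sum_distrib_left sum_divide_distrib
    by (intro sum.cong) (auto simp: alt_zeta_term_def)
  ultimately show ?thesis by (simp add: has_sum_imp_sums)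
qed

section \<open>The Beta function as a sum of two binomial series\<close>

text \<open>
  With \<open>p\<^sub>N = (b)\<^sub>N / N!\<close> the identity \<open>p\<^sub>N - p\<^sub>N\<^sub>+\<^sub>1 = (1 - b) p\<^sub>N / (N + 1)\<close> turns the series into a
  telescoping one, and it converges because \<open>p\<close> is decreasing and nonnegative.
\<close>

lemma summable_pochhammer_div:
  fixes b :: real
  assumes "0 < b" "b < 1"
  shows "summable (\<lambda>N. pochhammer b N / fact N / real (Suc N))"
proof -
  define p where "p N = pochhammer b N / fact N" for N
  have p_nonneg: "p N \<ge> 0" for N
    using assms pochhammer_pos[of b N] by (simp add: p_def)
  have step: "p N - p (Suc N) = (1 - b) * (p N / real (Suc N))" for N
  proof -
    have "p (Suc N) = p N * ((b + real N) / real (Suc N))" by (simp add: p_def pochhammer_Suc)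
    then show ?thesis by (simp add: field_simps)
  qed
  have "decseq p"
  proof (rule decseq_SucI)
    fix N
    have "(1 - b) * (p N / real (Suc N)) \<ge> 0" using assms p_nonneg by simp
    then show "p (Suc N) \<le> p N" using step[of N] by linarith
  qed
  then obtain L where "p \<longlonglongrightarrow> L" using decseq_convergent[of p 0] p_nonneg by blast
  then have "summable (\<lambda>N. p N - p (Suc N))" by (rule telescope_summable')
  then have "summable (\<lambda>N. p N / real (Suc N))"
    unfolding step using assms by (subst (asm) summable_cmult_iff) auto
  then show ?thesis by (simp only: p_def)
qed

text \<open>
  The range \<open>u > -1\<close> includes the negative values of \<open>u\<close> that occur in the dominating series of
  \<open>alt_zeta_poly_sums\<close>.
\<close>

lemma summable_gbinomial_div:
  fixes b u :: real
  assumes "0 < b" "b < 1" "- 1 < u"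
  shows "summable (\<lambda>N. \<bar>(- b gchoose N) / (real N + u)\<bar>)"
proof -
  \<comment> \<open>the linear bound \<open>N + u \<ge> N (1 + w)\<close> for \<open>N \<ge> 1\<close> needs \<open>-1 < w \<le> 0\<close>\<close>
  define w where "w = min u 0"
  have w: "- 1 < w" "w \<le> 0" "w \<le> u" using assms by (auto simp: w_def)
  define c where "c = 2 / (1 + w)"
  show ?thesis
  proof (rule summable_comparison_test'[where N = 1])
    show "summable (\<lambda>N. c * (pochhammer b N / fact N / real (Suc N)))"
      using summable_pochhammer_div[OF assms(1,2)] by (rule summable_mult)
  next
    fix N :: nat assume N: "N \<ge> 1"
    then have "w * real N \<le> w" using w by (cases "w = 0") (auto simp: mult_le_cancel_left1)
    then have *: "real N * (1 + w) \<le> real N + u" using w by (simp add: algebra_simps)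
    have pos: "0 < real N * (1 + w)" using N w by simp
    with * have pos': "0 < real N + u" by linarith
    have "inverse (real N + u) \<le> inverse (real N * (1 + w))"
      using * pos by (rule le_imp_inverse_le)
    also have "\<dots> \<le> c * inverse (real (Suc N))"
      using N w by (simp add: c_def divide_simps)
    finally have "pochhammer b N / fact N * inverse (real N + u) \<le>
        pochhammer b N / fact N * (c * inverse (real (Suc N)))"
      using pochhammer_pos[OF assms(1), of N] by (intro mult_left_mono) auto
    moreover have "\<bar>- b gchoose N\<bar> = pochhammer b N / fact N"
      using pochhammer_pos[OF assms(1), of N] by (simp add: gbinomial_pochhammer abs_mult)
    moreover have "norm \<bar>(- b gchoose N) / (real N + u)\<bar> = \<bar>- b gchoose N\<bar> * inverse (real N + u)"
      using pos' by (simp add: divide_inverse abs_mult)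
    moreover have "c * (pochhammer b N / fact N / real (Suc N))
        = pochhammer b N / fact N * (c * inverse (real (Suc N)))"
      by (simp add: divide_inverse)
    ultimately show "norm \<bar>(- b gchoose N) / (real N + u)\<bar>
        \<le> c * (pochhammer b N / fact N / real (Suc N))"
      by simp
  qed
qed

text \<open>
  Let \<open>h(t) = \<Sum>\<^sub>N C(-(u + v), N) t\<^sup>N / (N + u)\<close>.  By the binomial series,
  \<open>u h(t) + t h'(t) = (1 + t)\<^sup>-\<^sup>u\<^sup>-\<^sup>v\<close>, so \<open>t\<^sup>u h(t)\<close> is an antiderivative of
  \<open>t\<^sup>u\<^sup>-\<^sup>1 (1 + t)\<^sup>-\<^sup>u\<^sup>-\<^sup>v\<close>.  The substitution \<open>t = x / (1 - x)\<close> transports it to the integrand of the Beta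
  integral and maps \<open>[0, 1/2]\<close> to \<open>[0, 1]\<close>.  At \<open>t = 1\<close> the power series for \<open>h\<close> is at the
  boundary of its disc, but it converges absolutely and \<open>h\<close> is continuous there.
\<close>

lemma has_integral_Beta_left_half:
  fixes u v :: real
  assumes "0 < u" "0 < v" "u + v < 1"
  shows "((\<lambda>x. x powr (u - 1) * (1 - x) powr (v - 1)) has_integral
           suminf (\<lambda>N. (- (u + v) gchoose N) / (real N + u))) {0..1/2}"
proof -
  define a where "a N = (- (u + v) gchoose N) / (real N + u)" for N
  have abs: "summable (\<lambda>N. \<bar>a N\<bar>)"
    unfolding a_def by (rule summable_gbinomial_div) (use assms in auto)
  define h where "h t = suminf (\<lambda>N. a N * t ^ N)" for t
  define h' where "h' t = suminf (\<lambda>N. diffs a N * t ^ N)" for t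
  have cont_h: "continuous_on {0..1} h"
  proof (rule uniform_limit_theorem[OF _ _ sequentially_bot])
    show "uniform_limit {0..1} (\<lambda>n t. \<Sum>N<n. a N * t ^ N) h sequentially"
      unfolding h_def
      by (rule Weierstrass_m_test[OF _ abs]) (auto simp: abs_mult power_le_one intro!: mult_left_le)
  qed (intro always_eventually allI continuous_intros)
  have sm: "summable (\<lambda>N. a N * t ^ N)" if "\<bar>t\<bar> < 1" for t
    by (rule powser_inside[of a 1]) (use abs that in \<open>auto intro: summable_rabs_cancel\<close>)
  have dh: "(h has_real_derivative h' t) (at t)" if "\<bar>t\<bar> < 1" for t
    unfolding h_def h'_def
    by (rule termdiffs_strong[where K = 1]) (use abs that in \<open>auto intro: summable_rabs_cancel\<close>)
  have ode: "u * h t + t * h' t = (1 + t) powr (- (u + v))" if t: "\<bar>t\<bar> < 1" for t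
  proof -
    have "summable (\<lambda>N. diffs a N * t ^ N)"
      by (rule termdiff_converges[of t 1]) (use sm t in auto)
    then have "(\<lambda>N. real N * a N * t ^ (N - Suc 0)) sums h' t"
      unfolding h'_def by (rule diffs_equiv)
    then have "(\<lambda>N. t * (real N * a N * t ^ (N - Suc 0))) sums (t * h' t)"
      by (rule sums_mult)
    also have "(\<lambda>N. t * (real N * a N * t ^ (N - Suc 0))) = (\<lambda>N. real N * a N * t ^ N)"
    proof
      show "t * (real N * a N * t ^ (N - Suc 0)) = real N * a N * t ^ N" for N
        by (cases N) auto
    qed
    finally have "(\<lambda>N. u * (a N * t ^ N) + real N * a N * t ^ N) sums (u * h t + t * h' t)"
      unfolding h_def by (intro sums_add sums_mult summable_sums sm t)
    moreover have "u * (a N * t ^ N) + real N * a N * t ^ N = (- (u + v) gchoose N) * t ^ N" for N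
    proof -
      have "u * (a N * t ^ N) + real N * a N * t ^ N = (a N * (real N + u)) * t ^ N"
        by (simp add: algebra_simps)
      also have "a N * (real N + u) = (- (u + v) gchoose N)"
        using assms by (simp add: a_def)
      finally show ?thesis .
    qed
    ultimately have "(\<lambda>N. (- (u + v) gchoose N) * t ^ N) sums (u * h t + t * h' t)" by simp
    with gen_binomial_real[OF t] show ?thesis by (rule sums_unique2[symmetric])
  qed
  define \<Psi> where "\<Psi> x = (x / (1 - x)) powr u * h (x / (1 - x))" for x
  have "((\<lambda>x. x powr (u - 1) * (1 - x) powr (v - 1)) has_integral (\<Psi> (1/2) - \<Psi> 0)) {0..1/2}"
  proof (rule fundamental_theorem_of_calculus_interior)
    show "continuous_on {0..1/2} \<Psi>"
      unfolding \<Psi>_def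
    proof (rule continuous_on_mult)
      show "continuous_on {0..1/2} (\<lambda>x. (x / (1 - x)) powr u)"
        using assms by (intro continuous_on_powr' continuous_intros) auto
      show "continuous_on {0..1/2} (\<lambda>x. h (x / (1 - x)))"
        by (rule continuous_on_compose2[OF cont_h]) (auto intro!: continuous_intros simp: field_simps)
    qed
  next
    fix x :: real assume "x \<in> {0<..<1/2}"
    then have x: "0 < x" "x < 1 / 2" by auto
    define t where "t = x / (1 - x)"
    have t: "0 < t" "t < 1" using x by (auto simp: t_def field_simps)
    have dt: "((\<lambda>x. x / (1 - x)) has_real_derivative 1 / (1 - x)\<^sup>2) (at x)"
      using x by (auto intro!: derivative_eq_intros simp: power2_eq_square field_simps)
    have powr: "((\<lambda>t. t powr u) has_real_derivative u * t powr (u - 1)) (at t)"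
      using t by (auto intro!: derivative_eq_intros)
    have "((\<lambda>t. t powr u * h t) has_real_derivative u * t powr (u - 1) * h t + h' t * t powr u) (at t)"
      by (rule DERIV_mult[OF powr dh]) (use t in auto)
    then have "(\<Psi> has_real_derivative (u * t powr (u - 1) * h t + h' t * t powr u) * (1 / (1 - x)\<^sup>2)) (at x)"
      using DERIV_chain2[OF _ dt, of "\<lambda>t. t powr u * h t"] by (simp add: \<Psi>_def[abs_def] t_def)
    also have "(u * t powr (u - 1) * h t + h' t * t powr u) * (1 / (1 - x)\<^sup>2)
        = t powr (u - 1) * (u * h t + t * h' t) * (1 / (1 - x)\<^sup>2)"
      using t by (simp add: powr_diff field_simps)
    also have "u * h t + t * h' t = (1 + t) powr (- (u + v))" using t by (intro ode) auto
    also have "1 + t = 1 / (1 - x)" using x by (simp add: t_def field_simps)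
    also have "t powr (u - 1) = x powr (u - 1) / (1 - x) powr (u - 1)"
      using x by (simp add: t_def powr_divide)
    also have "(1 / (1 - x)) powr (- (u + v)) = (1 - x) powr (u + v)"
      unfolding powr_minus[of _ "u + v"] using x by (simp add: powr_divide)
    also have "(1 - x)\<^sup>2 = (1 - x) powr 2" using x by simp
    also have "x powr (u - 1) / (1 - x) powr (u - 1) * (1 - x) powr (u + v) * (1 / (1 - x) powr 2)
        = x powr (u - 1) * (1 - x) powr ((u + v) - (u - 1) - 2)"
      by (simp only: powr_diff) (simp add: field_simps)
    also have "(u + v) - (u - 1) - 2 = v - 1" by simp
    finally show "(\<Psi> has_vector_derivative x powr (u - 1) * (1 - x) powr (v - 1)) (at x)"
      by (simp add: has_real_derivative_iff_has_vector_derivative)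
  qed simp
  then show ?thesis by (simp add: \<Psi>_def h_def a_def)
qed

text \<open>
  The reflection \<open>x \<mapsto> 1 - x\<close> carries \<open>[1/2, 1]\<close> to \<open>[0, 1/2]\<close> and exchanges \<open>u\<close> and \<open>v\<close>.
\<close>

lemma Beta_eq_series:
  fixes u v :: real
  assumes "0 < u" "0 < v" "u + v < 1"
  shows "Beta u v = suminf (\<lambda>N. (- (u + v) gchoose N) / (real N + u))
                  + suminf (\<lambda>N. (- (u + v) gchoose N) / (real N + v))" (is "_ = ?S u + ?S v")
proof -
  let ?f = "\<lambda>x. x powr (u - 1) * (1 - x) powr (v - 1)"
  have left: "(?f has_integral ?S u) {0..1/2}"
    using assms by (rule has_integral_Beta_left_half)
  have "((\<lambda>x. x powr (v - 1) * (1 - x) powr (u - 1)) has_integral ?S v) (cbox 0 (1/2))"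
    using has_integral_Beta_left_half[of v u] assms by (simp add: add.commute)
  from has_integral_affinity[OF this, of "- 1" 1]
  have "(?f has_integral ?S v) ((\<lambda>x. - x + 1) ` {0..1/2})"
    by (simp add: mult.commute)
  also have "(\<lambda>x. - x + 1) ` {0..1/2} = {1/2..1::real}"
    using image_affinity_atLeastAtMost[of "-1" 1 0 "1/2::real"] by simp
  finally have "(?f has_integral (?S u + ?S v)) {0..1}"
    using left by (intro has_integral_combine[of 0 "1/2" 1]) auto
  with has_integral_Beta_real[OF assms(1,2)] show ?thesis by (rule has_integral_unique)
qed

section \<open>The generating function of the alternating zeta values\<close>

text \<open>
  The values of weight \<open>d + 2\<close>, arranged by the size of the last argument.
\<close>

definition alt_zeta_poly :: "nat \<Rightarrow> real poly" where
  "alt_zeta_poly d = (\<Sum>i\<le>d. monom (alt_zeta (d - i) (i + 2)) i)"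

lemma poly_alt_zeta_poly: "poly (alt_zeta_poly d) x = (\<Sum>i\<le>d. alt_zeta (d - i) (i + 2) * x ^ i)"
  by (simp add: alt_zeta_poly_def poly_sum poly_monom)

text \<open>
  The term with largest index \<open>M + 1\<close> of the generating function: the Cauchy product of
  \<open>\<Sum>\<^sub>p harmonic_esym p M s\<^sup>p\<close> and the geometric series of \<open>1 / (M + 1 - x s)\<close>.
\<close>

lemma harmonic_esym_Cauchy_product:
  fixes s x :: real
  assumes "\<bar>x * s\<bar> < real (Suc M)"
  shows "(\<lambda>d. s ^ Suc d * (\<Sum>i\<le>d. harmonic_esym (d - i) M / real (Suc M) ^ (i + 2) * x ^ i))
           sums (pochhammer s (Suc M) / fact (Suc M) / (real (Suc M) - x * s))"
proof -
  define q where "q = x * s / real (Suc M)"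
  have q: "norm q < 1" using assms by (simp add: q_def)
  define b where "b p = harmonic_esym p M * s ^ p" for p
  have b0: "b p = 0" if "p \<notin> {..M}" for p
    using that by (simp add: b_def harmonic_esym_eq_0)
  have b: "b sums (pochhammer (1 + s) M / fact M)"
    unfolding sum_harmonic_esym[symmetric] b_def[symmetric] by (rule sums_finite[OF _ b0]) simp_all
  have nb: "summable (\<lambda>p. norm (b p))"
    by (rule summable_finite[of "{..M}"]) (simp_all add: b0)
  have "(\<lambda>d. \<Sum>i\<le>d. q ^ i * b (d - i)) sums (suminf (\<lambda>i. q ^ i) * suminf b)"
    using q nb by (intro Cauchy_product_sums) (auto simp: power_abs intro: summable_geometric)
  also have "suminf b = pochhammer (1 + s) M / fact M" using b by (simp add: sums_iff)
  also have "suminf (\<lambda>i. q ^ i) = 1 / (1 - q)" using q by (rule suminf_geometric)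
  finally have "(\<lambda>d. s / real (Suc M) ^ 2 * (\<Sum>i\<le>d. q ^ i * b (d - i))) sums
      (s / real (Suc M) ^ 2 * (1 / (1 - q) * (pochhammer (1 + s) M / fact M)))"
    by (rule sums_mult)
  also have "(\<lambda>d. s / real (Suc M) ^ 2 * (\<Sum>i\<le>d. q ^ i * b (d - i))) =
      (\<lambda>d. s ^ Suc d * (\<Sum>i\<le>d. harmonic_esym (d - i) M / real (Suc M) ^ (i + 2) * x ^ i))"
  proof
    fix d
    show "s / real (Suc M) ^ 2 * (\<Sum>i\<le>d. q ^ i * b (d - i)) =
        s ^ Suc d * (\<Sum>i\<le>d. harmonic_esym (d - i) M / real (Suc M) ^ (i + 2) * x ^ i)"
      unfolding sum_distrib_left
    proof (rule sum.cong)
      fix i assume "i \<in> {..d}"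
      then have "s ^ d = s ^ i * s ^ (d - i)" by (simp flip: power_add)
      then show "s / real (Suc M) ^ 2 * (q ^ i * b (d - i)) =
          s ^ Suc d * (harmonic_esym (d - i) M / real (Suc M) ^ (i + 2) * x ^ i)"
        by (simp add: q_def b_def power_divide power_mult_distrib power_add power2_eq_square mult_ac
              del: of_nat_Suc)
    qed simp
  qed
  also have "s / real (Suc M) ^ 2 * (1 / (1 - q) * (pochhammer (1 + s) M / fact M))
      = pochhammer s (Suc M) / fact (Suc M) / (real (Suc M) - x * s)"
  proof -
    have "real (Suc M) - x * s = real (Suc M) * (1 - q)"
      by (simp add: q_def right_diff_distrib del: of_nat_Suc)
    moreover have "pochhammer s (Suc M) / fact (Suc M)
        = s * pochhammer (1 + s) M / (real (Suc M) * fact M)"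
      by (simp add: pochhammer_rec add.commute)
    ultimately show ?thesis by (simp add: power2_eq_square del: of_nat_Suc)
  qed
  finally show ?thesis .
qed

text \<open>
  The term \<open>N = M + 1\<close> of the binomial series is expanded by \<open>harmonic_esym_Cauchy_product\<close>, and
  the sums over \<open>M\<close> and over the degree \<open>d\<close> are interchanged.  The dominating array is the same
  expansion with all signs positive; it belongs to the denominators \<open>N - x s\<close> instead of \<open>N + x s\<close>.
  The subtracted \<open>1 / (x s)\<close> is the term \<open>N = 0\<close>.
\<close>

lemma alt_zeta_poly_sums:
  fixes s x :: real
  assumes "0 < s" "s < 1" "0 < x" "x < 1"
  shows "(\<lambda>d. poly (alt_zeta_poly d) (- x) * s ^ Suc d)
           sums (suminf (\<lambda>N. (- s gchoose N) / (real N + x * s)) - 1 / (x * s))"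
proof -
  define F where "F M d = (- 1) ^ Suc M * (s ^ Suc d *
      (\<Sum>i\<le>d. harmonic_esym (d - i) M / real (Suc M) ^ (i + 2) * (- x) ^ i))" for M d
  define G where "G M d = s ^ Suc d *
      (\<Sum>i\<le>d. harmonic_esym (d - i) M / real (Suc M) ^ (i + 2) * x ^ i)" for M d
  define r where "r M = (- s gchoose Suc M) / (real (Suc M) + x * s)" for M
  define g where "g M = \<bar>(- s gchoose Suc M) / (real (Suc M) + - (x * s))\<bar>" for M
  have xs: "0 < x * s" "x * s < 1"
    using assms mult_strict_mono[of x 1 s 1] by auto
  have small: "\<bar>x * s\<bar> < real (Suc M)" "\<bar>(- x) * s\<bar> < real (Suc M)" for M
    using xs by (auto simp: abs_mult)
  have pos: "pochhammer s (Suc M) > 0" for M using assms by (intro pochhammer_pos)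
  have swap: "summable r \<and> (\<lambda>d. poly (alt_zeta_poly d) (- x) * s ^ Suc d) sums suminf r"
  proof (rule double_series_swap)
    fix M d
    have "\<bar>\<Sum>i\<le>d. harmonic_esym (d - i) M / real (Suc M) ^ (i + 2) * (- x) ^ i\<bar>
        \<le> (\<Sum>i\<le>d. \<bar>harmonic_esym (d - i) M / real (Suc M) ^ (i + 2) * (- x) ^ i\<bar>)"
      by (rule sum_abs)
    also have "\<dots> = (\<Sum>i\<le>d. harmonic_esym (d - i) M / real (Suc M) ^ (i + 2) * x ^ i)"
      using assms by (simp add: abs_mult power_abs harmonic_esym_nonneg)
    finally show "\<bar>F M d\<bar> \<le> G M d"
      using assms by (simp add: F_def G_def abs_mult)
  next
    fix M
    have "pochhammer s (Suc M) / fact (Suc M) / (real (Suc M) - x * s) = g M"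
      using pos[of M] xs small(1)[of M]
      by (simp add: g_def gbinomial_pochhammer abs_mult del: fact_Suc of_nat_Suc)
    then show "G M sums g M"
      using harmonic_esym_Cauchy_product[OF small(1)[of M]] by (simp only: G_def[abs_def])
  next
    show "summable g"
      unfolding g_def
      by (rule summable_Suc_iff[THEN iffD2, OF summable_gbinomial_div]) (use assms xs in auto)
  next
    fix M
    have "(\<lambda>d. F M d) sums ((- 1) ^ Suc M *
        (pochhammer s (Suc M) / fact (Suc M) / (real (Suc M) - (- x) * s)))"
      unfolding F_def by (intro sums_mult harmonic_esym_Cauchy_product small)
    also have "(- 1) ^ Suc M * (pochhammer s (Suc M) / fact (Suc M) / (real (Suc M) - (- x) * s)) = r M"
      by (simp add: r_def gbinomial_pochhammer del: fact_Suc of_nat_Suc)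
    finally show "F M sums r M" .
  next
    fix d
    have "(\<lambda>M. \<Sum>i\<le>d. (- 1) ^ Suc M * harmonic_esym (d - i) M / real (Suc M) ^ (i + 2) * (- x) ^ i)
        sums poly (alt_zeta_poly d) (- x)"
      unfolding poly_alt_zeta_poly by (intro sums_sum sums_mult2 alt_zeta_sums) simp
    then have "(\<lambda>M. (\<Sum>i\<le>d. (- 1) ^ Suc M * harmonic_esym (d - i) M / real (Suc M) ^ (i + 2) * (- x) ^ i)
        * s ^ Suc d) sums (poly (alt_zeta_poly d) (- x) * s ^ Suc d)"
      by (rule sums_mult2)
    moreover have "(\<Sum>i\<le>d. (- 1) ^ Suc M * harmonic_esym (d - i) M / real (Suc M) ^ (i + 2) * (- x) ^ i)
        * s ^ Suc d = F M d" for M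
      by (simp add: F_def sum_distrib_left sum_distrib_right mult_ac del: of_nat_Suc)
    ultimately show "(\<lambda>M. F M d) sums (poly (alt_zeta_poly d) (- x) * s ^ Suc d)" by simp
  qed
  have "(\<lambda>N. (- s gchoose N) / (real N + x * s)) sums (suminf r + 1 / (x * s))"
    using swap sums_Suc_iff[of "\<lambda>N. (- s gchoose N) / (real N + x * s)" "suminf r"]
    by (simp add: r_def[abs_def] summable_sums)
  with swap show ?thesis by (simp add: sums_iff)
qed

section \<open>The quotient of Gamma functions as a power series\<close>

lemma zeta_nat_sums:
  assumes "k \<ge> 2"
  shows "(\<lambda>n. 1 / real (Suc n) ^ k) sums zeta_nat k"
proof -
  have "summable (\<lambda>n. inverse (real n ^ k))" by (rule inverse_power_summable[OF assms])
  then have "summable (\<lambda>n. inverse (real (Suc n) ^ k))" by (subst summable_Suc_iff)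
  then show ?thesis unfolding zeta_nat_def by (simp add: inverse_eq_divide summable_sums)
qed

text \<open>
  Expand each term \<open>1 / (k + 1) - 1 / (k + 1 + t)\<close> of the series for the digamma function as a
  geometric series in \<open>t\<close> and interchange the sums.
\<close>

lemma Digamma_sums:
  fixes t :: real
  assumes "0 < t" "t < 1"
  shows "(\<lambda>n. (- 1) ^ n * zeta_nat (n + 2) * t ^ Suc n) sums (Digamma (1 + t) + euler_mascheroni)"
proof -
  define F where "F k n = (- 1) ^ n * (1 / real (Suc k) ^ (n + 2)) * t ^ Suc n" for k n
  define r where "r k = inverse (real (Suc k)) - inverse (1 + t + real k)" for k
  have geo: "(\<lambda>n. (1 / real (Suc k) ^ (n + 2)) * y ^ n) sums (1 / (real (Suc k) * (real (Suc k) - y)))"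
    if "\<bar>y\<bar> < 1" for y k
  proof -
    have "norm (y / real (Suc k)) < 1" using that by (simp add: field_simps)
    then have "(\<lambda>n. 1 / real (Suc k) ^ 2 * (y / real (Suc k)) ^ n) sums
        (1 / real (Suc k) ^ 2 * (1 / (1 - y / real (Suc k))))"
      by (intro sums_mult geometric_sums)
    moreover have "1 / real (Suc k) ^ 2 * (1 / (1 - y / real (Suc k))) = 1 / (real (Suc k) * (real (Suc k) - y))"
      using that by (simp add: power2_eq_square divide_simps del: of_nat_Suc)
    moreover have "1 / real (Suc k) ^ 2 * (y / real (Suc k)) ^ n = (1 / real (Suc k) ^ (n + 2)) * y ^ n" for n
      by (simp add: power_divide power_add power2_eq_square mult_ac del: of_nat_Suc)
    ultimately show ?thesis by simp
  qed
  have "summable r \<and> (\<lambda>n. (- 1) ^ n * zeta_nat (n + 2) * t ^ Suc n) sums suminf r"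
  proof (rule double_series_swap)
    show "\<bar>F k n\<bar> \<le> t * ((1 / real (Suc k) ^ (n + 2)) * t ^ n)" for k n
      using assms by (simp add: F_def abs_mult del: of_nat_Suc)
    show "(\<lambda>n. t * ((1 / real (Suc k) ^ (n + 2)) * t ^ n)) sums
        (t * (1 / (real (Suc k) * (real (Suc k) - t))))" for k
      using assms by (intro sums_mult geo) auto
    show "summable (\<lambda>k. t * (1 / (real (Suc k) * (real (Suc k) - t))))"
    proof (rule summable_comparison_test'[where N = 0])
      show "summable (\<lambda>k. t / (1 - t) * (1 / real (Suc k) ^ 2))"
        using zeta_nat_sums[of 2] by (intro summable_mult) (auto simp: sums_iff)
      fix k
      have "real (Suc k) * (1 - t) \<le> real (Suc k) - t"
        using assms by (simp add: algebra_simps)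
      then have "1 / (real (Suc k) * (real (Suc k) - t)) \<le> 1 / (real (Suc k) * (real (Suc k) * (1 - t)))"
        using assms by (intro divide_left_mono mult_left_mono mult_pos_pos) auto
      then have "t * (1 / (real (Suc k) * (real (Suc k) - t))) \<le>
          t * (1 / (real (Suc k) * (real (Suc k) * (1 - t))))"
        using assms by (intro mult_left_mono) auto
      also have "\<dots> = t / (1 - t) * (1 / real (Suc k) ^ 2)"
        by (simp add: power2_eq_square del: of_nat_Suc)
      finally show "norm (t * (1 / (real (Suc k) * (real (Suc k) - t)))) \<le> t / (1 - t) * (1 / real (Suc k) ^ 2)"
        using assms by (simp add: abs_mult)
    qed
    show "F k sums r k" for k
    proof -
      have "(\<lambda>n. t * ((1 / real (Suc k) ^ (n + 2)) * (- t) ^ n)) sums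
          (t * (1 / (real (Suc k) * (real (Suc k) - (- t)))))"
        using assms by (intro sums_mult geo) auto
      moreover have "t * ((1 / real (Suc k) ^ (n + 2)) * (- t) ^ n) = F k n" for n
        unfolding power_minus[of t] by (simp add: F_def del: of_nat_Suc)
      moreover have "t * (1 / (real (Suc k) * (real (Suc k) - (- t)))) = r k"
        using assms by (simp add: r_def divide_simps)
      ultimately show ?thesis by simp
    qed
    show "(\<lambda>k. F k n) sums ((- 1) ^ n * zeta_nat (n + 2) * t ^ Suc n)" for n
      unfolding F_def by (intro sums_mult sums_mult2 zeta_nat_sums) simp
  qed
  moreover have "suminf r = Digamma (1 + t) + euler_mascheroni"
    by (simp add: Digamma_def r_def[abs_def])
  ultimately show ?thesis by simp
qed

definition symmetrized_poly :: "nat \<Rightarrow> real poly" where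
  "symmetrized_poly d = pcompose (alt_zeta_poly d) [:0, -1:] + pcompose (alt_zeta_poly d) [:-1, 1:]"

lemma poly_symmetrized_poly:
  "poly (symmetrized_poly d) x = poly (alt_zeta_poly d) (- x) + poly (alt_zeta_poly d) (- (1 - x))"
  by (simp add: symmetrized_poly_def poly_pcompose)

text \<open>
  The coefficients of \<open>s\<^sup>n\<close> in \<open>\<Gamma>(1 + x s) \<Gamma>(1 + (1 - x) s) / \<Gamma>(1 + s)\<close>, as polynomials in \<open>x\<close>.
\<close>

fun Gamma_quot_coeff :: "nat \<Rightarrow> real poly" where
  "Gamma_quot_coeff 0 = 1"
| "Gamma_quot_coeff (Suc 0) = 0"
| "Gamma_quot_coeff (Suc (Suc d)) = [:0, 1, -1:] * symmetrized_poly d"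

text \<open>
  The coefficients of the logarithmic derivative of the same quotient.  There is no constant term,
  since the Euler--Mascheroni constants of the three factors enter with weights
  \<open>x + (1 - x) - 1 = 0\<close>.
\<close>

fun log_deriv_coeff :: "nat \<Rightarrow> real poly" where
  "log_deriv_coeff 0 = 0"
| "log_deriv_coeff (Suc n) =
     smult ((- 1) ^ n * zeta_nat (n + 2)) (monom 1 (n + 2) + [:1, -1:] ^ (n + 2) - 1)"

definition Gamma_quot :: "real \<Rightarrow> real \<Rightarrow> real" where
  "Gamma_quot x s = Gamma (1 + x * s) * Gamma (1 + (1 - x) * s) / Gamma (1 + s)"

text \<open>
  The quotient is \<open>x (1 - x) s\<close> times the Beta function, to which the two binomial series apply.
  The terms \<open>1 / u\<close> and \<open>1 / v\<close> contribute the constant \<open>1\<close>.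
\<close>

lemma Gamma_quot_sums:
  fixes s x :: real
  assumes "0 < s" "s < 1" "0 < x" "x < 1"
  shows "(\<lambda>n. poly (Gamma_quot_coeff n) x * s ^ n) sums Gamma_quot x s"
proof -
  define u v where "u = x * s" and "v = (1 - x) * s"
  have uv: "0 < u" "0 < v" "u + v = s" using assms by (auto simp: u_def v_def algebra_simps)
  have "(\<lambda>d. poly (alt_zeta_poly d) (- x) * s ^ Suc d + poly (alt_zeta_poly d) (- (1 - x)) * s ^ Suc d)
      sums (suminf (\<lambda>N. (- s gchoose N) / (real N + u)) - 1 / u
        + (suminf (\<lambda>N. (- s gchoose N) / (real N + v)) - 1 / v))"
    unfolding u_def v_def using assms by (intro sums_add alt_zeta_poly_sums) auto
  also have "suminf (\<lambda>N. (- s gchoose N) / (real N + u)) - 1 / u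
        + (suminf (\<lambda>N. (- s gchoose N) / (real N + v)) - 1 / v) = Beta u v - 1 / u - 1 / v"
    using Beta_eq_series[OF uv(1,2)] uv assms by simp
  finally have "(\<lambda>d. x * (1 - x) * s * (poly (alt_zeta_poly d) (- x) * s ^ Suc d
      + poly (alt_zeta_poly d) (- (1 - x)) * s ^ Suc d)) sums (x * (1 - x) * s * (Beta u v - 1 / u - 1 / v))"
    by (rule sums_mult)
  also have "x * (1 - x) * s * (Beta u v - 1 / u - 1 / v) = Gamma_quot x s - 1"
  proof -
    have "y \<notin> \<int>\<^sub>\<le>\<^sub>0" if "y > 0" for y :: real
      using that by (auto elim!: nonpos_Ints_cases)
    then have "Gamma_quot x s = u * Gamma u * (v * Gamma v) / (s * Gamma s)"
      using Gamma_plus1[of u] Gamma_plus1[of v] Gamma_plus1[of s] uv assms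
      by (simp add: Gamma_quot_def u_def[symmetric] v_def[symmetric] add.commute)
    also have "\<dots> = x * (1 - x) * s * Beta u v"
      using assms uv by (simp add: Beta_def) (simp add: u_def v_def)
    finally have "x * (1 - x) * s * Beta u v = Gamma_quot x s" ..
    moreover have "x * (1 - x) * s * (1 / u) + x * (1 - x) * s * (1 / v) = 1"
      using assms by (simp add: u_def v_def)
    ultimately show ?thesis by (simp add: right_diff_distrib)
  qed
  also have "(\<lambda>d. x * (1 - x) * s * (poly (alt_zeta_poly d) (- x) * s ^ Suc d
      + poly (alt_zeta_poly d) (- (1 - x)) * s ^ Suc d)) =
      (\<lambda>d. poly (Gamma_quot_coeff (Suc (Suc d))) x * s ^ Suc (Suc d))"
    by (rule ext) (simp add: poly_symmetrized_poly algebra_simps)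
  finally have "(\<lambda>d. poly (Gamma_quot_coeff (Suc (Suc d))) x * s ^ Suc (Suc d)) sums (Gamma_quot x s - 1)" .
  from sums_Suc[OF this[THEN sums_Suc[of "\<lambda>d. poly (Gamma_quot_coeff (Suc d)) x * s ^ Suc d"]]]
  show ?thesis by simp
qed

lemma Gamma_quot_deriv:
  fixes s x :: real
  assumes "0 < s" "0 < x" "x < 1"
  shows "(Gamma_quot x has_real_derivative
    Gamma_quot x s * (x * Digamma (1 + x * s) + (1 - x) * Digamma (1 + (1 - x) * s) - Digamma (1 + s))) (at s)"
proof -
  have pos: "1 + x * s > 0" "1 + (1 - x) * s > 0" "1 + s > 0"
    using assms by (auto intro!: add_pos_pos mult_pos_pos)
  then have "Gamma (1 + s) > 0" by simp
  then have "Gamma (1 + s) \<noteq> 0" by linarith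
  then show ?thesis
    unfolding Gamma_quot_def[abs_def] using pos
    by (auto intro!: derivative_eq_intros simp: field_simps power2_eq_square elim!: nonpos_Ints_cases)
qed

lemma log_deriv_sums:
  fixes s x :: real
  assumes "0 < s" "s < 1" "0 < x" "x < 1"
  shows "(\<lambda>n. poly (log_deriv_coeff n) x * s ^ n) sums
    (x * Digamma (1 + x * s) + (1 - x) * Digamma (1 + (1 - x) * s) - Digamma (1 + s))"
proof -
  have small: "0 < y * s" "y * s < 1" if "0 < y" "y < 1" for y
    using that assms mult_strict_mono[of y 1 s 1] by auto
  let ?c = "\<lambda>n y. (- 1) ^ n * zeta_nat (n + 2) * y ^ Suc n"
  have "(\<lambda>n. x * ?c n (x * s) + (1 - x) * ?c n ((1 - x) * s) - ?c n s) sums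
      (x * (Digamma (1 + x * s) + euler_mascheroni)
        + (1 - x) * (Digamma (1 + (1 - x) * s) + euler_mascheroni)
        - (Digamma (1 + s) + euler_mascheroni))"
    using assms small[of x] small[of "1 - x"]
    by (intro sums_diff sums_add sums_mult Digamma_sums) auto
  also have "(\<lambda>n. x * ?c n (x * s) + (1 - x) * ?c n ((1 - x) * s) - ?c n s) =
      (\<lambda>n. poly (log_deriv_coeff (Suc n)) x * s ^ Suc n)"
  proof
    fix n
    define y where "y = 1 - x"
    have "x * ?c n (x * s) + y * ?c n (y * s) - ?c n s
        = (- 1) ^ n * zeta_nat (n + 2) * (x ^ (n + 2) + y ^ (n + 2) - 1) * s ^ Suc n"
      by (simp add: power_mult_distrib algebra_simps)
    then show "x * ?c n (x * s) + (1 - x) * ?c n ((1 - x) * s) - ?c n s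
        = poly (log_deriv_coeff (Suc n)) x * s ^ Suc n"
      unfolding log_deriv_coeff.simps y_def by (simp only: poly_smult poly_diff poly_add poly_monom poly_power poly_1) simp
  qed
  finally have "(\<lambda>n. poly (log_deriv_coeff (Suc n)) x * s ^ Suc n) sums
      (x * (Digamma (1 + x * s) + euler_mascheroni)
        + (1 - x) * (Digamma (1 + (1 - x) * s) + euler_mascheroni)
        - (Digamma (1 + s) + euler_mascheroni))" .
  from sums_Suc[OF this] show ?thesis by (simp add: algebra_simps)
qed

text \<open>
  Compare coefficients in \<open>B' = B D\<close>, where \<open>B\<close> is the quotient of Gamma functions and \<open>D\<close> its
  logarithmic derivative.
\<close>

lemma Gamma_quot_coeff_recurrence_pointwise:
  fixes x :: real
  assumes x: "0 < x" "x < 1"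
  shows "real (Suc n) * poly (Gamma_quot_coeff (Suc n)) x =
    (\<Sum>i\<le>n. poly (log_deriv_coeff i) x * poly (Gamma_quot_coeff (n - i)) x)"
proof -
  define b where "b n = poly (Gamma_quot_coeff n) x" for n
  define c where "c n = poly (log_deriv_coeff n) x" for n
  define D where "D s = x * Digamma (1 + x * s) + (1 - x) * Digamma (1 + (1 - x) * s) - Digamma (1 + s)" for s
  have b_sums: "(\<lambda>n. b n * s ^ n) sums Gamma_quot x s" if "0 < s" "s < 1" for s
    using Gamma_quot_sums[OF that x] by (simp add: b_def)
  have c_sums: "(\<lambda>n. c n * s ^ n) sums D s" if "0 < s" "s < 1" for s
    using log_deriv_sums[OF that x] by (simp add: c_def D_def)
  have inside: "summable (\<lambda>n. norm (a n * s ^ n))"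
    if s: "\<bar>s\<bar> < 1" and sm: "\<And>s. 0 < s \<Longrightarrow> s < 1 \<Longrightarrow> summable (\<lambda>n. a n * s ^ n)" for a :: "nat \<Rightarrow> real" and s
  proof -
    obtain y where y: "\<bar>s\<bar> < y" "y < 1" using dense[OF s] by blast
    then have "0 < y" by linarith
    from powser_insidea[OF sm[OF this y(2)], of s] y show ?thesis by simp
  qed
  have b_summable: "summable (\<lambda>n. norm (b n * s ^ n))" if "\<bar>s\<bar> < 1" for s
    by (rule inside[OF that]) (rule sums_summable[OF b_sums])
  have b_summable': "summable (\<lambda>n. b n * s ^ n)" if "\<bar>s\<bar> < 1" for s
    by (rule summable_norm_cancel[OF b_summable[OF that]])
  have c_summable: "summable (\<lambda>n. norm (c n * s ^ n))" if "\<bar>s\<bar> < 1" for s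
    by (rule inside[OF that]) (rule sums_summable[OF c_sums])
  have "(\<lambda>n. (diffs b n - (\<Sum>i\<le>n. c i * b (n - i))) * s ^ n) sums 0" if s: "0 < s" "s < 1" for s
  proof -
    have s': "norm s < 1" using s by simp
    have "((\<lambda>z. suminf (\<lambda>n. b n * z ^ n)) has_real_derivative suminf (\<lambda>n. diffs b n * s ^ n)) (at s)"
      by (rule termdiffs_strong'[OF _ s']) (use b_summable' in auto)
    then have "(Gamma_quot x has_real_derivative suminf (\<lambda>n. diffs b n * s ^ n)) (at s)"
    proof (rule has_field_derivative_transform_within_open[where S = "{0<..<1}"])
      show "suminf (\<lambda>n. b n * z ^ n) = Gamma_quot x z" if "z \<in> {0<..<1}" for z
        using b_sums[of z] that by (simp add: sums_iff)
    qed (use s in auto)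
    moreover have "(Gamma_quot x has_real_derivative Gamma_quot x s * D s) (at s)"
      unfolding D_def using s x by (intro Gamma_quot_deriv)
    ultimately have "suminf (\<lambda>n. diffs b n * s ^ n) = Gamma_quot x s * D s"
      by (rule DERIV_unique)
    moreover have "summable (\<lambda>n. diffs b n * s ^ n)"
      by (rule termdiff_converges[OF s']) (use b_summable' in auto)
    ultimately have left: "(\<lambda>n. diffs b n * s ^ n) sums (Gamma_quot x s * D s)"
      by (simp add: sums_iff)
    have "(\<lambda>n. \<Sum>i\<le>n. (c i * s ^ i) * (b (n - i) * s ^ (n - i))) sums (D s * Gamma_quot x s)"
      using Cauchy_product_sums[OF c_summable b_summable, of s s] b_sums[OF s] c_sums[OF s] s
      by (simp add: sums_iff)
    also have "(\<lambda>n. \<Sum>i\<le>n. (c i * s ^ i) * (b (n - i) * s ^ (n - i)))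
        = (\<lambda>n. (\<Sum>i\<le>n. c i * b (n - i)) * s ^ n)"
    proof
      fix n
      have "(c i * s ^ i) * (b (n - i) * s ^ (n - i)) = c i * b (n - i) * s ^ n" if "i \<le> n" for i
      proof -
        have "s ^ n = s ^ i * s ^ (n - i)" using that by (simp flip: power_add)
        then show ?thesis by simp
      qed
      then show "(\<Sum>i\<le>n. (c i * s ^ i) * (b (n - i) * s ^ (n - i))) = (\<Sum>i\<le>n. c i * b (n - i)) * s ^ n"
        unfolding sum_distrib_right by (intro sum.cong) auto
    qed
    finally have right: "(\<lambda>n. (\<Sum>i\<le>n. c i * b (n - i)) * s ^ n) sums (D s * Gamma_quot x s)" .
    show ?thesis using sums_diff[OF left right] by (simp add: left_diff_distrib mult.commute[of "Gamma_quot x s"])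
  qed
  from power_series_zero_right[OF zero_less_one this, of n] show ?thesis
    by (simp add: diffs_def b_def c_def)
qed

lemma Gamma_quot_coeff_recurrence:
  "smult (real (Suc n)) (Gamma_quot_coeff (Suc n)) =
    (\<Sum>i\<le>n. log_deriv_coeff i * Gamma_quot_coeff (n - i))" (is "?L = ?R")
proof (rule ccontr)
  assume "?L \<noteq> ?R"
  then have "finite {x. poly (?L - ?R) x = 0}" by (intro poly_roots_finite) simp
  moreover have "{0<..<1} \<subseteq> {x. poly (?L - ?R) x = 0}"
    using Gamma_quot_coeff_recurrence_pointwise[of _ n] by (auto simp: poly_sum)
  ultimately have "finite {0<..<1::real}" by (rule rev_finite_subset)
  then show False using infinite_Ioo[of 0 "1 :: real"] by simp
qed

section \<open>All coefficients are polynomials in zeta values\<close>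

lemma log_deriv_coeff_in_zeta_ring:
  assumes "zeta_nat (Suc n) \<in> zeta_ring \<or> n = 0"
  shows "coeffs_in_zeta_ring (log_deriv_coeff n)"
proof (cases n)
  case 0
  then show ?thesis by (simp add: coeffs_in_zeta_ring_0)
next
  case (Suc k)
  then have "zeta_nat (k + 2) \<in> zeta_ring" using assms by simp
  then have "(- 1) ^ k * zeta_nat (k + 2) \<in> zeta_ring"
    by (rule zeta_ring_mult[OF zeta_ring_Rats, rotated]) (intro Rats_power Rats_minus_iff[THEN iffD2] Rats_1)
  then show ?thesis
    unfolding Suc log_deriv_coeff.simps
    by (intro coeffs_in_zeta_ring_smult coeffs_in_zeta_ring_diff coeffs_in_zeta_ring_add
        coeffs_in_zeta_ring_power coeffs_in_zeta_ring_monom coeffs_in_zeta_ring_pCons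
        coeffs_in_zeta_ring_1 coeffs_in_zeta_ring_0 zeta_ring_1 zeta_ring_uminus)
qed

lemma Gamma_quot_coeff_in_zeta_ring:
  assumes "\<And>k. 2 \<le> k \<Longrightarrow> k \<le> n \<Longrightarrow> zeta_nat k \<in> zeta_ring"
  shows "coeffs_in_zeta_ring (Gamma_quot_coeff n)"
  using assms
proof (induction n rule: less_induct)
  case (less n)
  show ?case
  proof (cases n)
    case 0
    then show ?thesis by (simp add: coeffs_in_zeta_ring_1)
  next
    case (Suc m)
    have "coeffs_in_zeta_ring (smult (1 / real (Suc m)) (smult (real (Suc m)) (Gamma_quot_coeff (Suc m))))"
      unfolding Gamma_quot_coeff_recurrence
    proof (intro coeffs_in_zeta_ring_smult coeffs_in_zeta_ring_sum coeffs_in_zeta_ring_mult)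
      show "1 / real (Suc m) \<in> zeta_ring" by (intro zeta_ring_Rats) auto
      fix i assume "i \<in> {..m}"
      then show "coeffs_in_zeta_ring (log_deriv_coeff i)"
        using less.prems[of "Suc i"] Suc by (intro log_deriv_coeff_in_zeta_ring) auto
      show "coeffs_in_zeta_ring (Gamma_quot_coeff (m - i))"
        using Suc less.prems by (intro less.IH) auto
    qed
    then show ?thesis by (simp add: Suc del: of_nat_Suc)
  qed
qed

lemma pcompose_monom: "pcompose (monom c n) q = smult c (q ^ n)"
  by (induction n) (simp_all add: monom_0 monom_Suc pcompose_pCons)

text \<open>
  The first summand belongs to \<open>U\<^sub>d(-x)\<close>, the second one to \<open>U\<^sub>d(x - 1)\<close>.
\<close>

lemma coeff_symmetrized_poly:
  "coeff (symmetrized_poly d) i = (\<Sum>j\<le>d. alt_zeta (d - j) (j + 2) *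
      ((if j = i then (- 1) ^ i else 0) + real (j choose i) * (- 1) ^ (j - i)))"
proof -
  have comp: "pcompose (alt_zeta_poly d) q = (\<Sum>j\<le>d. smult (alt_zeta (d - j) (j + 2)) (q ^ j))" for q
    by (simp add: alt_zeta_poly_def pcompose_sum pcompose_monom)
  have coeff: "coeff ([:a, b:] ^ j) i = real (j choose i) * b ^ i * a ^ (j - i)" for a b :: real and j
  proof (cases "i \<le> j")
    case False
    have "degree ([:a, b:] ^ j) \<le> degree [:a, b:] * j" by (rule degree_power_le)
    also have "\<dots> \<le> 1 * j" by (intro mult_right_mono) auto
    finally show ?thesis using False by (simp add: coeff_eq_0)
  qed (rule coeff_linear_poly_power)
  have 1: "coeff ([:0, - 1:] ^ j) i = (if j = i then (- 1) ^ i else (0 :: real))" for j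
    by (cases "i \<le> j") (auto simp: coeff)
  have 2: "coeff ([:- 1, 1:] ^ j) i = real (j choose i) * (- 1) ^ (j - i)" for j
    by (simp add: coeff)
  show ?thesis
    by (simp add: symmetrized_poly_def comp coeff_sum 1 2 sum.distrib[symmetric] distrib_left)
qed

lemma coeff_symmetrized_poly_Suc: "coeff (symmetrized_poly d) (Suc d) = 0"
  unfolding coeff_symmetrized_poly by (intro sum.neutral) auto

lemma alt_zeta_0:
  assumes "n \<ge> 2"
  shows "alt_zeta 0 n = (2 / 2 ^ n - 1) * zeta_nat n"
proof -
  have "(\<lambda>M. (- 1) ^ Suc M / real (Suc M) ^ n + 1 / real (Suc M) ^ n) sums (alt_zeta 0 n + zeta_nat n)"
    using alt_zeta_sums[OF assms, of 0] zeta_nat_sums[OF assms] by (intro sums_add) simp_all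
  moreover have "(\<lambda>k. (- 1) ^ Suc (2 * k + 1) / real (Suc (2 * k + 1)) ^ n
      + 1 / real (Suc (2 * k + 1)) ^ n) sums (2 / 2 ^ n * zeta_nat n)"
  proof -
    have "(- 1) ^ Suc (2 * k + 1) / real (Suc (2 * k + 1)) ^ n + 1 / real (Suc (2 * k + 1)) ^ n
        = 2 / 2 ^ n * (1 / real (Suc k) ^ n)" for k
    proof -
      have "real (Suc (2 * k + 1)) = 2 * real (Suc k)" by simp
      then show ?thesis by (simp add: power_mult_distrib del: of_nat_Suc)
    qed
    then show ?thesis using zeta_nat_sums[OF assms] by (simp only: sums_mult)
  qed
  then have "(\<lambda>M. (- 1) ^ Suc M / real (Suc M) ^ n + 1 / real (Suc M) ^ n) sums (2 / 2 ^ n * zeta_nat n)"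
  proof (subst (asm) sums_mono_reindex[where f = "\<lambda>M. (- 1) ^ Suc M / real (Suc M) ^ n + 1 / real (Suc M) ^ n"])
    fix M :: nat assume "M \<notin> range (\<lambda>k. 2 * k + 1)"
    then have "even M" by (metis oddE rangeI)
    then show "(- 1) ^ Suc M / real (Suc M) ^ n + 1 / real (Suc M) ^ n = 0" by simp
  qed (auto simp: strict_mono_def)
  ultimately have "alt_zeta 0 n + zeta_nat n = 2 / 2 ^ n * zeta_nat n"
    by (rule sums_unique2)
  then show ?thesis by (simp add: algebra_simps)
qed

text \<open>
  In the recurrence for the coefficient of \<open>s\<^sup>n\<close> in the quotient of Gamma functions, take the
  coefficient of \<open>x\<^sup>n\<close>.  On the left it is \<open>-2 n\<close> times \<open>T\<^sub>n\<^sub>-\<^sub>2\<close>, the alternating zeta value at \<open>n\<close>,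
  which is \<open>2\<^sup>1\<^sup>-\<^sup>n - 1\<close> times \<open>\<zeta>(n)\<close>.  On the right it is \<open>2 \<zeta>(n)\<close> plus an expression in
  smaller zeta values.  The resulting factor \<open>n (2 - 4 / 2\<^sup>n) - 2\<close> of \<open>\<zeta>(n)\<close> is positive for \<open>n \<ge> 4\<close>,
  while it vanishes for \<open>n = 2\<close>.
\<close>

lemma zeta_nat_even_step:
  assumes "even n" "n \<ge> 4" and IH: "\<And>k. 2 \<le> k \<Longrightarrow> k < n \<Longrightarrow> zeta_nat k \<in> zeta_ring"
  shows "zeta_nat n \<in> zeta_ring"
proof -
  define d where "d = n - 2"
  have n: "n = Suc (Suc d)" and d: "even d" "d > 0" using assms by (auto simp: d_def)
  have "coeff (symmetrized_poly d) d = (\<Sum>j\<le>d. if j = d then 2 * alt_zeta 0 n else 0)"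
    unfolding coeff_symmetrized_poly using d by (intro sum.cong) (auto simp: n)
  then have diag: "coeff (symmetrized_poly d) d = 2 * alt_zeta 0 n" by simp
  have "coeff (Gamma_quot_coeff n) n = coeff (symmetrized_poly d) (Suc d) - coeff (symmetrized_poly d) d"
    by (simp add: n)
  then have top: "coeff (Gamma_quot_coeff n) n = - 2 * ((2 / 2 ^ n - 1) * zeta_nat n)"
    unfolding diag coeff_symmetrized_poly_Suc using assms by (simp add: alt_zeta_0)
  have lead: "coeff (log_deriv_coeff (Suc d)) n = 2 * zeta_nat n"
    using d coeff_linear_power_neg[of "1 :: real" n] by (simp add: n del: power_Suc)
  define R where "R = (\<Sum>i\<le>d. log_deriv_coeff i * Gamma_quot_coeff (Suc d - i))"
  have "coeffs_in_zeta_ring R"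
    unfolding R_def
  proof (intro coeffs_in_zeta_ring_sum coeffs_in_zeta_ring_mult)
    fix i assume i: "i \<in> {..d}"
    then show "coeffs_in_zeta_ring (log_deriv_coeff i)"
      using IH[of "Suc i"] n by (intro log_deriv_coeff_in_zeta_ring) auto
    show "coeffs_in_zeta_ring (Gamma_quot_coeff (Suc d - i))"
      using IH n i by (intro Gamma_quot_coeff_in_zeta_ring) auto
  qed
  then have R: "coeff R n \<in> zeta_ring" by (simp add: coeffs_in_zeta_ring_def)
  have "smult (real n) (Gamma_quot_coeff n) = R + log_deriv_coeff (Suc d)"
    unfolding n Gamma_quot_coeff_recurrence by (simp add: R_def)
  then have "coeff (smult (real n) (Gamma_quot_coeff n)) n = coeff (R + log_deriv_coeff (Suc d)) n"
    by (rule arg_cong)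
  then have "real n * coeff (Gamma_quot_coeff n) n = coeff R n + 2 * zeta_nat n"
    by (simp only: coeff_smult coeff_add lead)
  then have eq: "(real n * (2 - 4 / 2 ^ n) - 2) * zeta_nat n = coeff R n"
    unfolding top by (simp add: algebra_simps)
  show ?thesis
  proof (rule zeta_ring_Rats_mult_cancel)
    show "(real n * (2 - 4 / 2 ^ n) - 2) * zeta_nat n \<in> zeta_ring" using R eq by simp
    show "real n * (2 - 4 / 2 ^ n) - 2 \<in> \<rat>" by (intro Rats_diff Rats_mult Rats_divide Rats_power) auto
    have "(2 :: real) ^ 4 \<le> 2 ^ n" using \<open>n \<ge> 4\<close> by (intro power_increasing) auto
    then have "1 \<le> 2 - 4 / (2 :: real) ^ n" by (simp add: field_simps)
    then have "4 * 1 \<le> real n * (2 - 4 / 2 ^ n)" using \<open>n \<ge> 4\<close> by (intro mult_mono) auto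
    then show "real n * (2 - 4 / 2 ^ n) - 2 \<noteq> 0" by linarith
  qed
qed

lemma zeta_nat_in_zeta_ring:
  assumes "n \<ge> 2"
  shows "zeta_nat n \<in> zeta_ring"
  using assms
proof (induction n rule: less_induct)
  case (less n)
  then consider "n = 2 \<or> n \<ge> 3 \<and> odd n" | "even n" "n \<ge> 4"
    by (cases "n = 2"; cases "n = 3") auto
  then show ?case
    by cases (auto intro: zeta_ring_generator zeta_nat_even_step less.IH)
qed

text \<open>
  Division by \<open>x - x\<^sup>2\<close> stays inside the ring because the lowest coefficient of this divisor is \<open>1\<close>.
\<close>

lemma symmetrized_poly_in_zeta_ring: "coeff (symmetrized_poly d) i \<in> zeta_ring"
proof (induction i)
  have "coeffs_in_zeta_ring (Gamma_quot_coeff (Suc (Suc d)))"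
    by (intro Gamma_quot_coeff_in_zeta_ring zeta_nat_in_zeta_ring)
  then have in_ring: "coeff ([:0, 1, -1:] * symmetrized_poly d) i \<in> zeta_ring" for i
    by (simp add: coeffs_in_zeta_ring_def)
  {
    case 0
    show ?case using in_ring[of 1] by simp
  next
    case (Suc i)
    show ?case using zeta_ring_add[OF in_ring[of "Suc (Suc i)"] Suc] by simp
  }
qed

section \<open>Elimination of the relations\<close>

lemma alt_zeta_relation:
  fixes d :: nat
  defines "T \<equiv> \<lambda>j. alt_zeta (d - j) (j + 2)"
  assumes "i \<le> d"
  shows "T i + (\<Sum>j\<le>d. (- 1) ^ j * real (j choose i) * T j) \<in> zeta_ring"
proof -
  have "(- 1) ^ i * coeff (symmetrized_poly d) i = (\<Sum>j\<le>d. (if j = i then T j else 0)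
      + (- 1) ^ j * real (j choose i) * T j)"
    unfolding coeff_symmetrized_poly sum_distrib_left
  proof (rule sum.cong)
    fix j
    have "(- 1) ^ i * (real (j choose i) * (- 1) ^ (j - i)) = (- 1) ^ j * real (j choose i)"
      by (cases "i \<le> j") (auto simp: power_add[symmetric])
    then show "(- 1) ^ i * (alt_zeta (d - j) (j + 2) * ((if j = i then (- 1) ^ i else 0)
          + real (j choose i) * (- 1) ^ (j - i)))
        = (if j = i then T j else 0) + (- 1) ^ j * real (j choose i) * T j"
      by (auto simp: T_def distrib_left mult_ac)
  qed simp
  also have "\<dots> = T i + (\<Sum>j\<le>d. (- 1) ^ j * real (j choose i) * T j)"
    using assms by (simp add: sum.distrib)
  finally have "T i + (\<Sum>j\<le>d. (- 1) ^ j * real (j choose i) * T j)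
      = (- 1) ^ i * coeff (symmetrized_poly d) i" ..
  also have "\<dots> \<in> zeta_ring"
    by (intro zeta_ring_mult symmetrized_poly_in_zeta_ring zeta_ring_Rats) simp
  finally show ?thesis .
qed

text \<open>
  After \<open>C(j, n) C(n, i) = C(j, i) C(j - i, n - i)\<close> this is the recurrence for the values \<open>E\<^sub>l(0)\<close>.
\<close>

lemma sum_choose_choose_euler_const:
  assumes "j \<le> d"
  shows "(\<Sum>n=i..d. real (n choose i) * euler_const (n - i) * real (j choose n))
    = (if j = i then 2 else 0) - real (j choose i) * euler_const (j - i)"
proof (cases "i \<le> j")
  case False
  then have "(\<Sum>n=i..d. real (n choose i) * euler_const (n - i) * real (j choose n)) = 0"
    by (intro sum.neutral) auto
  with False show ?thesis by simp
next
  case True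
  have "(\<Sum>n=i..d. real (n choose i) * euler_const (n - i) * real (j choose n))
      = (\<Sum>n=i..j. real (n choose i) * euler_const (n - i) * real (j choose n))"
    using assms by (intro sum.mono_neutral_right) auto
  also have "\<dots> = (\<Sum>n=i..j. real (j choose i) * (real (j - i choose (n - i)) * euler_const (n - i)))"
  proof (rule sum.cong)
    fix n assume "n \<in> {i..j}"
    then have "real (j choose n) * real (n choose i) = real (j choose i) * real (j - i choose (n - i))"
      using choose_mult[of i n j] by (simp flip: of_nat_mult)
    then show "real (n choose i) * euler_const (n - i) * real (j choose n)
        = real (j choose i) * (real (j - i choose (n - i)) * euler_const (n - i))"
      by (simp add: mult_ac)
  qed simp
  also have "\<dots> = real (j choose i) * (\<Sum>l\<le>j - i. real (j - i choose l) * euler_const l)"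
    unfolding sum_distrib_left using True
    by (intro sum.reindex_bij_witness[of _ "\<lambda>l. l + i" "\<lambda>n. n - i"]) auto
  also have "(\<Sum>l\<le>j - i. real (j - i choose l) * euler_const l)
      = (if j = i then 2 else 0) - euler_const (j - i)"
    using euler_const_recurrence[of "j - i"] True by auto
  finally show ?thesis by (simp add: right_diff_distrib)
qed

text \<open>
  Weight the relations for \<open>n \<ge> i\<close> by \<open>C(n, i) e\<^sub>n\<^sub>-\<^sub>i\<close> and add.  The value \<open>T\<^sub>j\<close> receives
  \<open>C(j, i) e\<^sub>j\<^sub>-\<^sub>i\<close> from the isolated terms and, by the preceding lemma, \<open>(-1)\<^sup>j\<close> times
  \<open>2 [j = i] - C(j, i) e\<^sub>j\<^sub>-\<^sub>i\<close> from the sums.  For even \<open>i\<close> the total is \<open>2 C(j, i) e\<^sub>j\<^sub>-\<^sub>i\<close>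
  in every case: for \<open>j = i\<close> and for odd \<open>j\<close> the two contributions agree, for even \<open>j > i\<close> they cancel
  and \<open>e\<^sub>j\<^sub>-\<^sub>i = 0\<close>.
\<close>

lemma even_alt_zeta_reduction:
  fixes d :: nat
  defines "T \<equiv> \<lambda>j. alt_zeta (d - j) (j + 2)"
  assumes "even i" "i \<le> d"
  shows "(\<Sum>j=i..d. real (j choose i) * euler_const (j - i) * T j) \<in> zeta_ring"
proof -
  define w where "w n = real (n choose i) * euler_const (n - i)" for n
  have "(\<Sum>n=i..d. w n * (T n + (\<Sum>j\<le>d. (- 1) ^ j * real (j choose n) * T j)))
      = (\<Sum>n=i..d. w n * T n) + (\<Sum>n=i..d. \<Sum>j\<le>d. (- 1) ^ j * T j * (w n * real (j choose n)))"
    by (simp add: distrib_left sum.distrib sum_distrib_left mult_ac)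
  also have "(\<Sum>n=i..d. \<Sum>j\<le>d. (- 1) ^ j * T j * (w n * real (j choose n)))
      = (\<Sum>j\<le>d. (- 1) ^ j * T j * (\<Sum>n=i..d. w n * real (j choose n)))"
    by (subst sum.swap) (simp add: sum_distrib_left)
  also have "\<dots> = (\<Sum>j\<le>d. (- 1) ^ j * T j * ((if j = i then 2 else 0) - w j))"
    unfolding w_def by (intro sum.cong refl) (simp add: sum_choose_choose_euler_const)
  also have "\<dots> = (\<Sum>j=i..d. (- 1) ^ j * T j * ((if j = i then 2 else 0) - w j))"
    by (intro sum.mono_neutral_right) (auto simp: w_def)
  also have "(\<Sum>n=i..d. w n * T n) + \<dots> = (\<Sum>j=i..d. 2 * (w j * T j))"
    unfolding sum.distrib[symmetric]
  proof (rule sum.cong)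
    fix j assume j: "j \<in> {i..d}"
    consider "j = i" | "j > i" "even j" | "odd j" using j by force
    then show "w j * T j + (- 1) ^ j * T j * ((if j = i then 2 else 0) - w j) = 2 * (w j * T j)"
    proof cases
      case 1
      have "euler_const 0 = 1" using euler_const_recurrence[of 0] by simp
      then show ?thesis using 1 \<open>even i\<close> by (simp add: w_def)
    next
      case 2
      then have "w j = 0" using \<open>even i\<close> by (simp add: w_def euler_const_even)
      then show ?thesis using 2 by simp
    next
      case 3
      then show ?thesis using \<open>even i\<close> by auto
    qed
  qed simp
  finally have eq: "(\<Sum>n=i..d. w n * (T n + (\<Sum>j\<le>d. (- 1) ^ j * real (j choose n) * T j)))
      = 2 * (\<Sum>j=i..d. w j * T j)"
    by (simp add: sum_distrib_left)
  have "(\<Sum>n=i..d. w n * (T n + (\<Sum>j\<le>d. (- 1) ^ j * real (j choose n) * T j))) \<in> zeta_ring"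
  proof (intro zeta_ring_sum zeta_ring_mult)
    fix n assume "n \<in> {i..d}"
    then show "T n + (\<Sum>j\<le>d. (- 1) ^ j * real (j choose n) * T j) \<in> zeta_ring"
      unfolding T_def by (intro alt_zeta_relation) auto
    show "w n \<in> zeta_ring"
      unfolding w_def by (intro zeta_ring_Rats Rats_mult euler_const_Rats) auto
  qed
  then have "(\<Sum>j=i..d. w j * T j) \<in> zeta_ring"
    unfolding eq by (rule zeta_ring_Rats_mult_cancel) auto
  then show ?thesis by (simp add: w_def)
qed

theorem mainTheorem1:
  fixes k m :: nat
  assumes "k \<ge> 1" and "m \<ge> 1"
  shows "\<exists>P :: rat_mpoly. mpoly_vars P \<subseteq> {2} \<union> {2 * i + 1 | i. i \<ge> 1} \<and>
    alt_zeta k (2 * m) = mpoly_eval zeta_nat P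
      - (\<Sum>n = m + 1..m + nat \<lceil>real k / 2\<rceil>.
          coeff (euler_poly (2 * n - 3)) (2 * m - 2) * alt_zeta (k + 1 - 2 * (n - m)) (2 * n - 1))"
proof -
  define i d where "i = 2 * m - 2" and "d = i + k"
  define t where "t j = real (j choose i) * euler_const (j - i) * alt_zeta (d - j) (j + 2)" for j
  let ?S = "\<Sum>n = m + 1..m + nat \<lceil>real k / 2\<rceil>.
    coeff (euler_poly (2 * n - 3)) (2 * m - 2) * alt_zeta (k + 1 - 2 * (n - m)) (2 * n - 1)"
  have ceil: "nat \<lceil>real k / 2\<rceil> = (k + 1) div 2" by linarith
  have "even i" by (simp add: i_def)
  have "i + 2 = 2 * m" using \<open>m \<ge> 1\<close> by (simp add: i_def)
  then have "t i = alt_zeta k (2 * m)"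
    unfolding t_def using euler_const_recurrence[of 0] by (simp add: d_def)
  moreover have "(\<Sum>j=Suc i..d. t j) = ?S"
  proof -
    have "(\<Sum>j=Suc i..d. t j) = (\<Sum>j\<in>{j \<in> {Suc i..d}. odd j}. t j)"
      using \<open>even i\<close> by (intro sum.mono_neutral_right) (auto simp: t_def euler_const_even)
    also have "\<dots> = ?S"
      unfolding ceil
    \<comment> \<open>odd indices \<open>j > i = 2 m - 2\<close> are \<open>j = 2 n - 3\<close> with \<open>n > m\<close>\<close>
    proof (rule sum.reindex_bij_witness[of _ "\<lambda>n. 2 * n - 3" "\<lambda>j. (j + 3) div 2"])
      fix j assume j: "j \<in> {j \<in> {Suc i..d}. odd j}"
      then obtain l where l: "j = 2 * l + 1" by (auto elim: oddE)
      show "2 * ((j + 3) div 2) - 3 = j" by (simp add: l)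
      show "(j + 3) div 2 \<in> {m + 1..m + (k + 1) div 2}"
        using j l \<open>m \<ge> 1\<close> by (auto simp: i_def d_def)
      have *: "2 * ((j + 3) div 2) - 3 = j" "2 * ((j + 3) div 2) - 1 = j + 2"
        "k + 1 - 2 * ((j + 3) div 2 - m) = d - j"
        using j l \<open>m \<ge> 1\<close> by (auto simp: i_def d_def)
      show "coeff (euler_poly (2 * ((j + 3) div 2) - 3)) (2 * m - 2) *
          alt_zeta (k + 1 - 2 * ((j + 3) div 2 - m)) (2 * ((j + 3) div 2) - 1) = t j"
        unfolding * using j coeff_euler_poly[of i j] by (simp add: t_def i_def)
    next
      fix n assume n: "n \<in> {m + 1..m + (k + 1) div 2}"
      then show "2 * n - 3 \<in> {j \<in> {Suc i..d}. odd j}"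
        using \<open>m \<ge> 1\<close> by (auto simp: i_def d_def)
      show "(2 * n - 3 + 3) div 2 = n" using n \<open>m \<ge> 1\<close> by auto
    qed
    finally show ?thesis .
  qed
  moreover have "(\<Sum>j=i..d. t j) = t i + (\<Sum>j=Suc i..d. t j)"
    by (rule sum.atLeast_Suc_atMost) (simp add: d_def)
  moreover have "(\<Sum>j=i..d. t j) \<in> zeta_ring"
    unfolding t_def by (rule even_alt_zeta_reduction) (simp_all add: \<open>even i\<close> d_def)
  ultimately have "alt_zeta k (2 * m) + ?S \<in> zeta_ring" by simp
  then obtain P where "mpoly_vars P \<subseteq> {2} \<union> {2 * i + 1 | i. i \<ge> 1}"
    and "alt_zeta k (2 * m) + ?S = mpoly_eval zeta_nat P"
    unfolding zeta_ring_def by auto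
  then show ?thesis by (intro exI[of _ P]) (auto simp: algebra_simps)
qed

end
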